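(* Let $K$ be a field. Given a decreasing function $f:\mathbb N\to\mathbb N$ with $$f(0)=2\lim_{k\to\infty}f(k)+1$$ for which $\Delta f$ is decreasing, there exist a polynomial ring $S$ in finitely many variables over $K$ and a monomial ideal $I\subset S$ such that $\operatorname{depth}S/I^k=f(k)$ for all $k\ge1$.
   Context: $\mathbb N=\{0,1,2,\ldots\}$. For $f:\mathbb N\to\mathbb N$, the function $\Delta f$ is defined by $(\Delta f)(k)=f(k)-f(k+1)$ for all $k\in\mathbb N$. "Decreasing" is meant in the weak sense (nonincreasing). Depth is with respect to the graded maximal ideal of $S$. *)

theory Defs
  imports
    Complex_Main
    "HOL-Algebra.Module"
    "HOL-Algebra.QuotRing"
    "HOL-Algebra.Ideal_Product"
    "HOL-Library.Poly_Mapping"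
    "HOL-Library.Extended_Nat"
begin

section \<open>Polynomial rings and monomial ideals\<close>

text \<open>
  The type \<open>(nat \<Rightarrow>\<^sub>0 nat) \<Rightarrow>\<^sub>0 'k\<close> is the polynomial ring over \<open>'k\<close> in the variables
  \<open>X\<^sub>0, X\<^sub>1, \<dots>\<close>: an element of \<open>nat \<Rightarrow>\<^sub>0 nat\<close> is an exponent vector, and
  multiplication is convolution. The number of variables has to be
  existentially quantified, so \<open>K[X\<^sub>0, \<dots>, X\<^sub>n\<^sub>-\<^sub>1]\<close> is carved out as a carrier set.
\<close>

definition poly_ring :: "nat \<Rightarrow> ((nat \<Rightarrow>\<^sub>0 nat) \<Rightarrow>\<^sub>0 'k::field) ring"
  where "poly_ring n =
    \<lparr>carrier = {p. \<forall>m \<in> Poly_Mapping.keys p. Poly_Mapping.keys m \<subseteq> {..<n}},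
     mult = (*), one = 1, zero = 0, add = (+)\<rparr>"

definition monomials :: "nat \<Rightarrow> ((nat \<Rightarrow>\<^sub>0 nat) \<Rightarrow>\<^sub>0 'k::field) set"
  where "monomials n = {Poly_Mapping.single m 1 | m. Poly_Mapping.keys m \<subseteq> {..<n}}"

definition monomial_ideal :: "nat \<Rightarrow> ((nat \<Rightarrow>\<^sub>0 nat) \<Rightarrow>\<^sub>0 'k::field) set \<Rightarrow> bool"
  where "monomial_ideal n I \<longleftrightarrow> (\<exists>G \<subseteq> monomials n. I = genideal (poly_ring n) G)"

definition graded_maximal_ideal :: "nat \<Rightarrow> ((nat \<Rightarrow>\<^sub>0 nat) \<Rightarrow>\<^sub>0 'k::field) set"
  where "graded_maximal_ideal n =
    genideal (poly_ring n) {Poly_Mapping.single (Poly_Mapping.single i 1) 1 | i. i < n}"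

definition ideal_power :: "('a, 'b) ring_scheme \<Rightarrow> 'a set \<Rightarrow> nat \<Rightarrow> 'a set"
  where "ideal_power R I k = I [^]\<^bsub>ideals_set R\<^esub> k"


section \<open>Depth\<close>

text \<open>The ring \<open>R / J\<close>, equipped with its structure of an \<open>R\<close>-module.\<close>

definition quotient_module :: "('a, 'b) ring_scheme \<Rightarrow> 'a set \<Rightarrow> ('a, 'a set) module"
  where "quotient_module R J =
    \<lparr>carrier = carrier (R Quot J), mult = mult (R Quot J), one = one (R Quot J),
     zero = zero (R Quot J), add = add (R Quot J),
     smult = (\<lambda>a X. (J +>\<^bsub>R\<^esub> a) \<otimes>\<^bsub>R Quot J\<^esub> X)\<rparr>"

text \<open>The submodule \<open>X M\<close> of \<open>M\<close> generated by all \<open>x m\<close> with \<open>x \<in> X\<close> and \<open>m \<in> M\<close>.\<close>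

definition set_smult_module ::
    "('a, 'b) ring_scheme \<Rightarrow> ('a, 'c, 'd) module_scheme \<Rightarrow> 'a set \<Rightarrow> 'c set"
  where "set_smult_module R M X =
    \<Inter>{N. submodule N R M \<and> (\<forall>x \<in> X. \<forall>m \<in> carrier M. x \<odot>\<^bsub>M\<^esub> m \<in> N)}"

text \<open>
  The second conjunct says that \<open>x\<^sub>i\<close> is a nonzerodivisor on \<open>M / (x\<^sub>1, \<dots>, x\<^sub>i\<^sub>-\<^sub>1) M\<close>,
  with lists indexed from 0.
\<close>

definition regular_sequence ::
    "('a, 'b) ring_scheme \<Rightarrow> ('a, 'c, 'd) module_scheme \<Rightarrow> 'a list \<Rightarrow> bool"
  where "regular_sequence R M xs \<longleftrightarrow>
    set xs \<subseteq> carrier R \<and>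
    (\<forall>i < length xs. \<forall>m \<in> carrier M.
       xs ! i \<odot>\<^bsub>M\<^esub> m \<in> set_smult_module R M (set (take i xs)) \<longrightarrow>
       m \<in> set_smult_module R M (set (take i xs))) \<and>
    set_smult_module R M (set xs) \<noteq> carrier M"

text \<open>
  Depth of \<open>M\<close> with respect to the ideal \<open>J\<close>, with the usual convention that it is infinite
  if \<open>J M = M\<close>; in particular the zero module has infinite depth.
\<close>

definition depth ::
    "('a, 'b) ring_scheme \<Rightarrow> 'a set \<Rightarrow> ('a, 'c, 'd) module_scheme \<Rightarrow> enat"
  where "depth R J M =
    (if set_smult_module R M J = carrier M then \<infinity>
     else Sup {enat (length xs) | xs. regular_sequence R M xs \<and> set xs \<subseteq> J})"


section \<open>Difference function\<close>

definition Delta :: "(nat \<Rightarrow> nat) \<Rightarrow> nat \<Rightarrow> int"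
  where "Delta f k = int (f k) - int (f (k + 1))"


section \<open>Well-definedness\<close>

lemma cring_poly_ring: "cring (poly_ring n :: ((nat \<Rightarrow>\<^sub>0 nat) \<Rightarrow>\<^sub>0 'k::field) ring)"
proof -
  let ?C = "carrier (poly_ring n :: ((nat \<Rightarrow>\<^sub>0 nat) \<Rightarrow>\<^sub>0 'k) ring)"
  have add: "p + q \<in> ?C" if "p \<in> ?C" "q \<in> ?C" for p q
    using that Poly_Mapping.keys_add[of p q] by (auto simp: poly_ring_def)
  have mult: "p * q \<in> ?C" if p: "p \<in> ?C" and q: "q \<in> ?C" for p q
  proof -
    have "Poly_Mapping.keys m \<subseteq> {..<n}" if m: "m \<in> Poly_Mapping.keys (p * q)" for m
    proof -
      obtain a b where "m = a + b" "a \<in> Poly_Mapping.keys p" "b \<in> Poly_Mapping.keys q"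
        using m Poly_Mapping.keys_mult[of p q] by blast
      then show ?thesis
        using p q Poly_Mapping.keys_add[of a b] by (fastforce simp: poly_ring_def)
    qed
    then show ?thesis by (simp add: poly_ring_def)
  qed
  have uminus: "- p \<in> ?C" if "p \<in> ?C" for p
    using that by (simp add: poly_ring_def)
  have zero: "0 \<in> ?C" and one: "1 \<in> ?C"
    by (auto simp: poly_ring_def)
  have ops: "mult (poly_ring n) = ((*) :: _ \<Rightarrow> _ \<Rightarrow> (nat \<Rightarrow>\<^sub>0 nat) \<Rightarrow>\<^sub>0 'k)"
      "add (poly_ring n) = ((+) :: _ \<Rightarrow> _ \<Rightarrow> (nat \<Rightarrow>\<^sub>0 nat) \<Rightarrow>\<^sub>0 'k)"
      "\<one>\<^bsub>poly_ring n\<^esub> = (1 :: (nat \<Rightarrow>\<^sub>0 nat) \<Rightarrow>\<^sub>0 'k)" "\<zero>\<^bsub>poly_ring n\<^esub> = (0 :: (nat \<Rightarrow>\<^sub>0 nat) \<Rightarrow>\<^sub>0 'k)"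
    by (simp_all add: poly_ring_def)
  show ?thesis
  proof (rule cringI)
    show "abelian_group (poly_ring n :: ((nat \<Rightarrow>\<^sub>0 nat) \<Rightarrow>\<^sub>0 'k) ring)"
    proof (rule abelian_groupI)
      fix p assume "p \<in> ?C"
      then show "\<exists>q \<in> ?C. q \<oplus>\<^bsub>poly_ring n\<^esub> p = \<zero>\<^bsub>poly_ring n\<^esub>"
        by (intro bexI[of _ "- p"] uminus) (simp_all add: ops)
    qed (simp_all only: ops add zero add.assoc add.commute add.left_commute add_0_left add_0_right)
    show "comm_monoid (poly_ring n :: ((nat \<Rightarrow>\<^sub>0 nat) \<Rightarrow>\<^sub>0 'k) ring)"
      by (rule comm_monoidI) (simp_all only: ops mult one mult.assoc mult.commute mult.left_commute mult_1_left mult_1_right)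
  qed (simp add: ops distrib_right)
qed

lemma module_quotient_module:
  assumes "cring R" and "ideal J R"
  shows "Module.module R (quotient_module R J)"
proof -
  interpret cring R by fact
  interpret J: ideal J R by fact
  interpret Q: cring "R Quot J" by (rule J.quotient_is_cring[OF \<open>cring R\<close>])
  interpret h: ring_hom_ring R "R Quot J" "a_r_coset R J" by (rule J.rcos_ring_hom_ring)
  have ab: "abelian_group (quotient_module R J)"
  proof (intro abelian_groupI)
    fix x assume "x \<in> carrier (quotient_module R J)"
    then show "\<exists>y \<in> carrier (quotient_module R J).
        y \<oplus>\<^bsub>quotient_module R J\<^esub> x = \<zero>\<^bsub>quotient_module R J\<^esub>"
      using Q.l_neg Q.a_inv_closed unfolding quotient_module_def by fastforce
  qed (simp_all add: quotient_module_def Q.add.m_assoc Q.add.m_comm Q.add.m_lcomm)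
  show ?thesis
    by (intro moduleI \<open>cring R\<close> ab)
       (auto simp: quotient_module_def Q.l_distr Q.r_distr Q.m_assoc)
qed

lemma ideal_graded_maximal_ideal:
  "ideal (graded_maximal_ideal n :: ((nat \<Rightarrow>\<^sub>0 nat) \<Rightarrow>\<^sub>0 'k::field) set) (poly_ring n)"
  unfolding graded_maximal_ideal_def
  by (rule ring.genideal_ideal[OF cring.axioms(1)[OF cring_poly_ring]])
     (auto simp: poly_ring_def split: if_splits)

lemma ideal_monomial_ideal:
  assumes "monomial_ideal n I"
  shows "ideal I (poly_ring n)"
proof -
  have "monomials n \<subseteq> carrier (poly_ring n)"
    by (auto simp: poly_ring_def monomials_def)
  with assms show ?thesis
    unfolding monomial_ideal_def
    using ring.genideal_ideal[OF cring.axioms(1)[OF cring_poly_ring]] by blast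
qed

end

theory Submission
  imports Defs
begin

text \<open>
  Write \<open>c = lim f\<close>, and decompose the descent of \<open>f\<close> on \<open>k \<ge> 1\<close> into \<open>w = f 1 - c\<close> unit steps: step \<open>s\<close>
  happens at the first \<open>t\<^sub>s\<close> with \<open>f t\<^sub>s \<le> c + s\<close>. The hypotheses on \<open>f\<close> give \<open>w \<le> c\<close> and \<open>t\<^sub>s \<ge> 2\<close>.
  The ideal is \<open>I = x\<^sub>0 \<cdot> \<Prod>\<^sub>s (x\<^sub>s\<^bsup>t-1\<^esup> y\<^sub>s, x\<^sub>s\<^bsup>t-2\<^esup> y\<^sub>s z\<^sub>s, z\<^sub>s\<^sup>t)\<close> with \<open>t = t\<^sub>s\<close>, in a ring with \<open>c - w\<close> further
  free variables. In each power, the coefficient ideal of a power of \<open>z\<^sub>s\<close> in the \<open>s\<close>-th factor is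
  principal as long as \<open>k < t\<^sub>s\<close>. Therefore \<open>x\<^sub>s - x\<^sub>0\<close> for all \<open>s\<close>, \<open>y\<^sub>s - x\<^sub>0\<close> for \<open>k < t\<^sub>s\<close>, and \<open>v - x\<^sub>0\<close> for
  free \<open>v\<close> form a regular sequence of length \<open>w + (f k - c) + (c - w) = f k\<close> on \<open>S/I\<^sup>k\<close>. Dividing it out
  identifies these variables with \<open>x\<^sub>0\<close>, and the quotient by the resulting monomial ideal has a
  monomial that is killed by all variables. By an argument with Koszul cohomology, no regular
  sequence is then longer.
\<close>

section \<open>Regular sequences on a quotient of the ring\<close>

lemma (in ideal)
  shows carrier_quotient_module: "carrier (quotient_module R I) = (+>) I ` carrier R"
    and zero_quotient_module: "\<zero>\<^bsub>quotient_module R I\<^esub> = I"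
    and add_quotient_module: "\<lbrakk>a \<in> carrier R; b \<in> carrier R\<rbrakk> \<Longrightarrow>
      (I +> a) \<oplus>\<^bsub>quotient_module R I\<^esub> (I +> b) = I +> (a \<oplus> b)"
    and smult_quotient_module: "\<lbrakk>r \<in> carrier R; a \<in> carrier R\<rbrakk> \<Longrightarrow>
      r \<odot>\<^bsub>quotient_module R I\<^esub> (I +> a) = I +> (r \<otimes> a)"
  by (auto simp: quotient_module_def FactRing_def A_RCOSETS_def' a_rcos_sum rcoset_mult_add)

lemma (in cring) a_inv_quotient_module:
  assumes J: "ideal J R" and a: "a \<in> carrier R"
  shows "\<ominus>\<^bsub>quotient_module R J\<^esub> (J +> a) = J +> (\<ominus> a)"
proof -
  interpret J: ideal J R by fact
  interpret M: Module.module R "quotient_module R J"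
    using is_cring J by (rule module_quotient_module)
  have "(J +> (\<ominus> a)) \<oplus>\<^bsub>quotient_module R J\<^esub> (J +> a) = \<zero>\<^bsub>quotient_module R J\<^esub>"
    using a by (simp add: J.add_quotient_module J.zero_quotient_module l_neg J.a_rcos_const)
  then show ?thesis
    using a by (intro M.minus_equality) (simp_all add: J.carrier_quotient_module)
qed

text \<open>Supplies a competitor in the intersection that defines \<open>set_smult_module\<close>,
  hence an upper bound for \<open>X M\<close>.\<close>

lemma (in cring) coset_image_submodule:
  assumes J: "ideal J R" and I: "ideal I R" and "J \<subseteq> I"
  shows "submodule {J +> a | a. a \<in> I} R (quotient_module R J)"
proof -
  interpret J: ideal J R by fact
  interpret I: ideal I R by fact
  interpret M: Module.module R "quotient_module R J"
    using is_cring J by (rule module_quotient_module)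
  show ?thesis
  proof (rule M.submoduleI)
    show "{J +> a |a. a \<in> I} \<subseteq> carrier (quotient_module R J)"
      using J.carrier_quotient_module I.Icarr by blast
    show "\<zero>\<^bsub>quotient_module R J\<^esub> \<in> {J +> a |a. a \<in> I}"
      using J.zero_quotient_module J.a_rcos_const[OF J.zero_closed] I.zero_closed by blast
    show "\<ominus>\<^bsub>quotient_module R J\<^esub> x \<in> {J +> a |a. a \<in> I}" if "x \<in> {J +> a |a. a \<in> I}" for x
      using that a_inv_quotient_module[OF J I.Icarr] I.a_inv_closed by blast
    show "x \<oplus>\<^bsub>quotient_module R J\<^esub> y \<in> {J +> a |a. a \<in> I}"
      if "x \<in> {J +> a |a. a \<in> I}" "y \<in> {J +> a |a. a \<in> I}" for x y
      using that J.add_quotient_module[OF I.Icarr I.Icarr] I.a_closed by blast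
    show "r \<odot>\<^bsub>quotient_module R J\<^esub> x \<in> {J +> a |a. a \<in> I}"
      if "r \<in> carrier R" "x \<in> {J +> a |a. a \<in> I}" for r x
      using that J.smult_quotient_module[OF _ I.Icarr] I.I_l_closed by blast
  qed
qed

text \<open>Submodules of \<open>R / J\<close> correspond to ideals of \<open>R\<close> containing
  \<open>J\<close>: the image of \<open>Idl (J \<union> X)\<close> is one of the submodules
  intersected, and the preimage of each of them is an ideal containing
  \<open>J \<union> X\<close>.\<close>

lemma (in cring) coset_mem_set_smult_module_iff:
  assumes J: "ideal J R" and X: "X \<subseteq> carrier R" and a: "a \<in> carrier R"
  shows "J +> a \<in> set_smult_module R (quotient_module R J) X \<longleftrightarrow> a \<in> Idl (J \<union> X)"
proof -
  interpret J: ideal J R by fact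
  let ?M = "quotient_module R J"
  have JX: "J \<union> X \<subseteq> carrier R" using X J.Icarr by blast
  interpret I: ideal "Idl (J \<union> X)" R using JX by (rule genideal_ideal)
  have sub: "J \<union> X \<subseteq> Idl (J \<union> X)" using JX by (rule genideal_self)
  note carr = J.carrier_quotient_module and zero = J.zero_quotient_module
    and add = J.add_quotient_module and smult = J.smult_quotient_module
  show ?thesis
  proof
    assume "J +> a \<in> set_smult_module R ?M X"
    moreover have "x \<odot>\<^bsub>?M\<^esub> m \<in> {J +> b | b. b \<in> Idl (J \<union> X)}"
      if x: "x \<in> X" and m: "m \<in> carrier ?M" for x m
    proof -
      obtain b where "b \<in> carrier R" "m = J +> b" using m carr by auto
      then show ?thesis
        using x X sub smult I.I_r_closed by blast
    qed
    ultimately have "J +> a \<in> {J +> b | b. b \<in> Idl (J \<union> X)}"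
      using coset_image_submodule[OF J I.is_ideal] sub
      unfolding set_smult_module_def by blast
    then obtain b where b: "b \<in> Idl (J \<union> X)" "J +> a = J +> b" by blast
    \<comment> \<open>Equal cosets determine \<open>a\<close> only up to an element of
      \<open>J\<close>, which \<open>Idl (J \<union> X)\<close> absorbs.\<close>
    then have "a \<ominus> b \<in> J"
      using quotient_eq_iff_same_a_r_cos[OF J a] I.Icarr by blast
    then have "(a \<ominus> b) \<oplus> b \<in> Idl (J \<union> X)"
      using b sub by (meson I.a_closed UnCI subsetD)
    moreover have "(a \<ominus> b) \<oplus> b = a"
      using a b I.Icarr by (simp add: minus_eq a_assoc l_neg)
    ultimately show "a \<in> Idl (J \<union> X)" by simp
  next
    assume a: "a \<in> Idl (J \<union> X)"
    show "J +> a \<in> set_smult_module R ?M X"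
      unfolding set_smult_module_def
    proof (intro InterI, clarify)
      fix N assume N: "submodule N R ?M" and NX: "\<forall>x\<in>X. \<forall>m\<in>carrier ?M. x \<odot>\<^bsub>?M\<^esub> m \<in> N"
      interpret N: submodule N R ?M by fact
      have Nzero: "J \<in> N" using N.one_closed zero by simp
      have Nadd: "J +> (b \<oplus> c) \<in> N"
        if "b \<in> carrier R" "c \<in> carrier R" "J +> b \<in> N" "J +> c \<in> N" for b c
        using N.m_closed that add by fastforce
      have Nneg: "J +> (\<ominus> b) \<in> N" if "b \<in> carrier R" "J +> b \<in> N" for b
        using N.m_inv_closed[of "J +> b"] that a_inv_quotient_module[OF J, of b] unfolding a_inv_def by simp
      have Nmult: "J +> (r \<otimes> b) \<in> N" if "r \<in> carrier R" "b \<in> carrier R" "J +> b \<in> N" for r b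
        using N.smult_closed[of r "J +> b"] that by (simp add: smult)
      have "ideal {b \<in> carrier R. J +> b \<in> N} R"
      proof (rule idealI[OF ring_axioms])
        show "subgroup {b \<in> carrier R. J +> b \<in> N} (add_monoid R)"
          by (rule subgroup.intro)
             (use Nzero Nadd Nneg in \<open>auto simp: J.a_rcos_const simp flip: a_inv_def\<close>)
        show "x \<otimes> b \<in> {b \<in> carrier R. J +> b \<in> N}"
          if "b \<in> {b \<in> carrier R. J +> b \<in> N}" "x \<in> carrier R" for b x
          using that Nmult by auto
        then show "b \<otimes> x \<in> {b \<in> carrier R. J +> b \<in> N}"
          if "b \<in> {b \<in> carrier R. J +> b \<in> N}" "x \<in> carrier R" for b x
          using that m_comm[of b x] by auto
      qed
      moreover have "J \<union> X \<subseteq> {b \<in> carrier R. J +> b \<in> N}"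
      proof -
        have "J +> x \<in> N" if "x \<in> X" for x
        proof -
          \<comment> \<open>The coset of \<open>x\<close> is reached by acting on the coset of
            one.\<close>
          have "x \<odot>\<^bsub>?M\<^esub> (J +> \<one>) \<in> N"
            using NX that carr by blast
          then show ?thesis using that X by (simp add: smult subset_eq)
        qed
        then show ?thesis using JX Nzero J.a_rcos_const by auto
      qed
      ultimately have "Idl (J \<union> X) \<subseteq> {b \<in> carrier R. J +> b \<in> N}"
        by (rule genideal_minimal)
      with a show "J +> a \<in> N" by blast
    qed
  qed
qed

lemma (in cring) set_smult_module_eq_carrier_iff:
  assumes J: "ideal J R" and X: "X \<subseteq> carrier R"
  shows "set_smult_module R (quotient_module R J) X = carrier (quotient_module R J)
    \<longleftrightarrow> Idl (J \<union> X) = carrier R"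
proof -
  interpret J: ideal J R by fact
  interpret M: Module.module R "quotient_module R J"
    using is_cring J by (rule module_quotient_module)
  note carr = J.carrier_quotient_module
  have "submodule (carrier (quotient_module R J)) R (quotient_module R J)"
    by (rule M.carrier_is_submodule)
  then have sub: "set_smult_module R (quotient_module R J) X \<subseteq> carrier (quotient_module R J)"
    unfolding set_smult_module_def using X by (intro Inter_lower) auto
  have I: "ideal (Idl (J \<union> X)) R"
    using X J.Icarr by (intro genideal_ideal) blast
  show ?thesis
  proof
    assume "set_smult_module R (quotient_module R J) X = carrier (quotient_module R J)"
    then have "\<one> \<in> Idl (J \<union> X)"
      using coset_mem_set_smult_module_iff[OF J X one_closed] carr by blast
    then show "Idl (J \<union> X) = carrier R" by (rule ideal.one_imp_carrier[OF I])
  next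
    assume "Idl (J \<union> X) = carrier R"
    then show "set_smult_module R (quotient_module R J) X = carrier (quotient_module R J)"
      using sub coset_mem_set_smult_module_iff[OF J X] carr by auto
  qed
qed

text \<open>Turns regularity on the module \<open>R / J\<close> into colon conditions on ideals, so
  that the later arguments take place in the ring.\<close>

lemma (in cring) regular_sequence_quotient_iff:
  assumes J: "ideal J R"
  shows "regular_sequence R (quotient_module R J) xs \<longleftrightarrow>
    set xs \<subseteq> carrier R \<and>
    (\<forall>i < length xs. \<forall>a \<in> carrier R. xs ! i \<otimes> a \<in> Idl (J \<union> set (take i xs))
       \<longrightarrow> a \<in> Idl (J \<union> set (take i xs))) \<and>
    Idl (J \<union> set xs) \<noteq> carrier R"
proof -
  interpret J: ideal J R by fact
  note carr = J.carrier_quotient_module and smult = J.smult_quotient_module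
  have "(xs ! i \<odot>\<^bsub>quotient_module R J\<^esub> (J +> a)
        \<in> set_smult_module R (quotient_module R J) (set (take i xs)) \<longrightarrow>
      J +> a \<in> set_smult_module R (quotient_module R J) (set (take i xs))) \<longleftrightarrow>
    (xs ! i \<otimes> a \<in> Idl (J \<union> set (take i xs)) \<longrightarrow> a \<in> Idl (J \<union> set (take i xs)))"
    if "set xs \<subseteq> carrier R" "i < length xs" "a \<in> carrier R" for i a
  proof -
    have "set (take i xs) \<subseteq> carrier R" "xs ! i \<in> carrier R"
      using that set_take_subset[of i xs] nth_mem[of i xs] by blast+
    then show ?thesis
      using that by (simp add: smult coset_mem_set_smult_module_iff[OF J])
  qed
  then show ?thesis
    unfolding regular_sequence_def carr
    using set_smult_module_eq_carrier_iff[OF J, of "set xs"]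
    by (auto simp: carr)
qed

section \<open>Koszul cohomology\<close>

definition koszul_sign :: "'i::linorder \<Rightarrow> 'i set \<Rightarrow> 'a::comm_ring_1"
  where "koszul_sign j \<sigma> = (- 1) ^ card {i \<in> \<sigma>. i < j}"

text \<open>A cochain assigns to \<sigma> the coefficient of the exterior basis element of \<sigma>,
  and \<open>koszul_sign\<close> moves a basis vector to its place. The differential is exterior
  multiplication by the vector with coordinates \<open>x j\<close>.\<close>

definition koszul_d :: "('i::linorder \<Rightarrow> 'a::comm_ring_1) \<Rightarrow> ('i set \<Rightarrow> 'a) \<Rightarrow> 'i set \<Rightarrow> 'a"
  where "koszul_d x z \<sigma> = (\<Sum>j\<in>\<sigma>. koszul_sign j \<sigma> * x j * z (\<sigma> - {j}))"

text \<open>Contraction with the functional that takes the value \<open>a j\<close> on basis vector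
  \<open>j\<close>.\<close>

definition koszul_homotopy ::
    "'i::linorder set \<Rightarrow> ('i \<Rightarrow> 'a::comm_ring_1) \<Rightarrow> ('i set \<Rightarrow> 'a) \<Rightarrow> 'i set \<Rightarrow> 'a"
  where "koszul_homotopy N a z \<sigma> = (\<Sum>j\<in>N - \<sigma>. koszul_sign j \<sigma> * a j * z (insert j \<sigma>))"

lemma koszul_sign_square [simp]: "koszul_sign j \<sigma> * koszul_sign j \<sigma> = 1"
  by (simp add: koszul_sign_def flip: power_mult_distrib)

lemma koszul_sign_insert:
  assumes "finite \<sigma>" "i \<notin> \<sigma>"
  shows "koszul_sign j (insert i \<sigma>) = (if i < j then - koszul_sign j \<sigma> else koszul_sign j \<sigma>)"
proof (cases "i < j")
  case True
  then have "{l \<in> insert i \<sigma>. l < j} = insert i {l \<in> \<sigma>. l < j}" by auto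
  then show ?thesis using assms True by (simp add: koszul_sign_def)
next
  case False
  then have "{l \<in> insert i \<sigma>. l < j} = {l \<in> \<sigma>. l < j}" by auto
  then show ?thesis using False by (simp add: koszul_sign_def)
qed

lemma koszul_sign_Diff:
  assumes "finite \<sigma>" "i \<in> \<sigma>"
  shows "(koszul_sign j (\<sigma> - {i}) :: 'a::comm_ring_1)
    = (if i < j then - koszul_sign j \<sigma> else koszul_sign j \<sigma>)"
proof -
  have "(koszul_sign j \<sigma> :: 'a)
      = (if i < j then - koszul_sign j (\<sigma> - {i}) else koszul_sign j (\<sigma> - {i}))"
    using koszul_sign_insert[of "\<sigma> - {i}" i j] assms by (simp add: insert_absorb)
  then show ?thesis by simp
qed

lemma koszul_d_diff: "koszul_d x (\<lambda>\<sigma>. z \<sigma> - w \<sigma>) \<sigma> = koszul_d x z \<sigma> - koszul_d x w \<sigma>"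
  by (simp add: koszul_d_def right_diff_distrib sum_subtractf)

lemma koszul_d_scale: "koszul_d x (\<lambda>\<sigma>. c * z \<sigma>) \<sigma> = c * koszul_d x z \<sigma>"
  by (simp add: koszul_d_def sum_distrib_left ac_simps)

text \<open>Splitting by order, rather than by antisymmetry alone, also covers characteristic 2.\<close>

lemma koszul_d_d:
  assumes "finite \<sigma>"
  shows "koszul_d x (koszul_d x z) \<sigma> = 0"
proof -
  define F where "F = (\<lambda>(j, i). koszul_sign j \<sigma> * koszul_sign i (\<sigma> - {j})
    * x j * x i * z (\<sigma> - {j} - {i}))"
  define A where "A = {(j, i) \<in> \<sigma> \<times> \<sigma>. i < j}"
  define B where "B = {(j, i) \<in> \<sigma> \<times> \<sigma>. j < i}"
  have fin: "finite A" "finite B" "A \<inter> B = {}"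
    using assms by (auto simp: A_def B_def intro: finite_subset[of _ "\<sigma> \<times> \<sigma>"])
  have AB: "(SIGMA j:\<sigma>. \<sigma> - {j}) = A \<union> B"
    by (auto simp: A_def B_def)
  have "koszul_d x (koszul_d x z) \<sigma> = (\<Sum>j\<in>\<sigma>. \<Sum>i\<in>\<sigma> - {j}. F (j, i))"
    by (simp add: koszul_d_def F_def sum_distrib_left ac_simps)
  also have "\<dots> = sum F (SIGMA j:\<sigma>. \<sigma> - {j})"
    using assms by (subst sum.Sigma) auto
  also have "\<dots> = sum F A + sum F B"
    unfolding AB using fin by (rule sum.union_disjoint)
  \<comment> \<open>Removing \<open>j\<close> and \<open>i\<close> in either order leaves the same
    set, but exactly one of the two signs changes.\<close>
  also have "sum F B = (\<Sum>p\<in>A. - F p)"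
  proof (rule sum.reindex_bij_witness[of _ prod.swap prod.swap])
    fix p assume "p \<in> B"
    then obtain j i where p: "p = (j, i)" "j \<in> \<sigma>" "i \<in> \<sigma>" "j < i"
      by (auto simp: B_def)
    then show "- F (prod.swap p) = F p"
      using assms by (simp add: less_not_sym F_def koszul_sign_Diff Diff_insert2[symmetric] insert_commute ac_simps)
  qed (auto simp: A_def B_def)
  finally show ?thesis by (simp add: sum_negf)
qed

text \<open>Removing and inserting the same index gives \<open>a j * x j\<close>, once for each
  \<open>j \<in> N\<close>; the terms with two different indices cancel.\<close>

lemma koszul_homotopy:
  assumes "finite N" "\<sigma> \<subseteq> N"
  shows "koszul_d x (koszul_homotopy N a z) \<sigma> + koszul_homotopy N a (koszul_d x z) \<sigma>
    = (\<Sum>j\<in>N. a j * x j) * z \<sigma>"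
proof -
  have fin: "finite \<sigma>" using assms finite_subset by blast
  \<comment> \<open>The term that exchanges \<open>j \<in> \<sigma>\<close> for
    \<open>i \<notin> \<sigma>\<close>; the two composites produce it with opposite signs.\<close>
  define G where "G = (\<lambda>j i. koszul_sign j \<sigma> * koszul_sign i (\<sigma> - {j}) * x j * a i
    * z (insert i (\<sigma> - {j})))"
  have "koszul_d x (koszul_homotopy N a z) \<sigma>
      = (\<Sum>j\<in>\<sigma>. a j * x j * z \<sigma> + (\<Sum>i\<in>N - \<sigma>. G j i))"
    unfolding koszul_d_def
  proof (rule sum.cong)
    fix j assume j: "j \<in> \<sigma>"
    have "N - (\<sigma> - {j}) = insert j (N - \<sigma>)" using j assms by auto
    then have "koszul_sign j \<sigma> * x j * koszul_homotopy N a z (\<sigma> - {j})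
      = koszul_sign j \<sigma> * x j * (koszul_sign j (\<sigma> - {j}) * a j * z (insert j (\<sigma> - {j})))
        + (\<Sum>i\<in>N - \<sigma>. G j i)"
      using assms j by (simp add: koszul_homotopy_def G_def sum_distrib_left distrib_left ac_simps)
    also have "koszul_sign j \<sigma> * x j * (koszul_sign j (\<sigma> - {j}) * a j * z (insert j (\<sigma> - {j})))
      = (koszul_sign j \<sigma> * koszul_sign j \<sigma>) * (a j * x j * z \<sigma>)"
      using j fin by (simp add: koszul_sign_Diff insert_absorb ac_simps)
    finally show "koszul_sign j \<sigma> * x j * koszul_homotopy N a z (\<sigma> - {j})
      = a j * x j * z \<sigma> + (\<Sum>i\<in>N - \<sigma>. G j i)" by simp
  qed simp
  moreover have "koszul_homotopy N a (koszul_d x z) \<sigma>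
      = (\<Sum>i\<in>N - \<sigma>. a i * x i * z \<sigma> + (\<Sum>j\<in>\<sigma>. - G j i))"
    unfolding koszul_homotopy_def
  proof (rule sum.cong)
    fix i assume i: "i \<in> N - \<sigma>"
    define t where "t = (\<lambda>j. koszul_sign i \<sigma> * a i
      * (koszul_sign j (insert i \<sigma>) * x j * z (insert i \<sigma> - {j})))"
    have "koszul_sign i \<sigma> * a i * koszul_d x z (insert i \<sigma>) = t i + sum t \<sigma>"
      using i fin by (simp add: koszul_d_def sum_distrib_left t_def distrib_left)
    also have "t i = (koszul_sign i \<sigma> * koszul_sign i \<sigma>) * (a i * x i * z \<sigma>)"
      using i fin by (simp add: t_def koszul_sign_insert ac_simps)
    also have "sum t \<sigma> = (\<Sum>j\<in>\<sigma>. - G j i)"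
    proof (rule sum.cong)
      fix j assume j: "j \<in> \<sigma>"
      then have "i \<noteq> j" using i by auto
      then show "t j = - G j i"
        using i j fin by (auto simp: t_def G_def insert_Diff_if koszul_sign_insert koszul_sign_Diff ac_simps)
    qed simp
    finally show "koszul_sign i \<sigma> * a i * koszul_d x z (insert i \<sigma>)
      = a i * x i * z \<sigma> + (\<Sum>j\<in>\<sigma>. - G j i)" by simp
  qed simp
  moreover have "(\<Sum>i\<in>N - \<sigma>. \<Sum>j\<in>\<sigma>. G j i) = (\<Sum>j\<in>\<sigma>. \<Sum>i\<in>N - \<sigma>. G j i)"
    by (rule sum.swap)
  moreover have "(\<Sum>j\<in>N. a j * x j * z \<sigma>)
      = (\<Sum>j\<in>N - \<sigma>. a j * x j * z \<sigma>) + (\<Sum>j\<in>\<sigma>. a j * x j * z \<sigma>)"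
    using assms by (intro sum.subset_diff) auto
  ultimately show ?thesis
    by (simp add: sum.distrib sum_subtractf sum_negf sum_distrib_right)
qed

text \<open>
  The ring is a subring \<open>C\<close> of the type, since \<open>poly_ring n\<close> is carved out of a larger ring.
\<close>

locale koszul =
  fixes C :: "'a::comm_ring_1 set" and x :: "'i::linorder \<Rightarrow> 'a" and N :: "'i set"
  assumes zero_closed: "0 \<in> C" and one_closed: "1 \<in> C"
    and add_closed: "\<lbrakk>a \<in> C; b \<in> C\<rbrakk> \<Longrightarrow> a + b \<in> C"
    and uminus_closed: "a \<in> C \<Longrightarrow> - a \<in> C"
    and mult_closed: "\<lbrakk>a \<in> C; b \<in> C\<rbrakk> \<Longrightarrow> a * b \<in> C"
    and finite_N: "finite N" and x_closed: "i \<in> N \<Longrightarrow> x i \<in> C"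
begin

section \<open>Ideals, cohomology and regular chains over the subring\<close>

definition subideal :: "'a set \<Rightarrow> bool"
  where "subideal P \<longleftrightarrow> P \<subseteq> C \<and> 0 \<in> P \<and> (\<forall>a\<in>P. \<forall>b\<in>P. a + b \<in> P) \<and> (\<forall>a\<in>P. \<forall>c\<in>C. c * a \<in> P)"

definition span :: "'a set"
  where "span = {\<Sum>j\<in>N. a j * x j | a. a ` N \<subseteq> C}"

text \<open>Says that \<open>H^i\<close> of the Koszul complex over \<open>C / P\<close> is zero, in
  terms of representatives in \<open>C\<close>. One function on \<open>Pow N\<close> carries all
  degrees, and cardinality selects the degree. For \<open>i = 0\<close> coboundaries are empty
  sums.\<close>

definition cohomology_vanishes :: "'a set \<Rightarrow> nat \<Rightarrow> bool"
  where "cohomology_vanishes P i \<longleftrightarrow>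
    (\<forall>z. z ` Pow N \<subseteq> C \<and> (\<forall>\<sigma>\<subseteq>N. card \<sigma> = Suc i \<longrightarrow> koszul_d x z \<sigma> \<in> P) \<longrightarrow>
      (\<exists>w. w ` Pow N \<subseteq> C \<and> (\<forall>\<sigma>\<subseteq>N. card \<sigma> = i \<longrightarrow> z \<sigma> - koszul_d x w \<sigma> \<in> P)))"

definition regular_step :: "'a \<Rightarrow> 'a set \<Rightarrow> 'a set \<Rightarrow> bool"
  where "regular_step y P Q \<longleftrightarrow> y \<in> span \<and> (\<forall>a\<in>C. y * a \<in> P \<longrightarrow> a \<in> P) \<and>
    Q = {p + y * a | p a. p \<in> P \<and> a \<in> C}"

text \<open>
  \<open>y 0, \<dots>, y (e - 1)\<close> is regular modulo \<open>P 0\<close>, and \<open>P i\<close> is \<open>P 0 + (y 0, \<dots>, y (i - 1))\<close>.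
\<close>

definition regular_chain :: "(nat \<Rightarrow> 'a set) \<Rightarrow> (nat \<Rightarrow> 'a) \<Rightarrow> nat \<Rightarrow> bool"
  where "regular_chain P y e \<longleftrightarrow>
    (\<forall>i\<le>e. subideal (P i)) \<and> (\<forall>i<e. regular_step (y i) (P i) (P (Suc i)))"

lemma subidealD:
  assumes "subideal P"
  shows "P \<subseteq> C" "0 \<in> P" "\<And>a b. \<lbrakk>a \<in> P; b \<in> P\<rbrakk> \<Longrightarrow> a + b \<in> P" "\<And>a c. \<lbrakk>a \<in> P; c \<in> C\<rbrakk> \<Longrightarrow> c * a \<in> P"
    "\<And>a. a \<in> P \<Longrightarrow> - a \<in> P" "\<And>a b. \<lbrakk>a \<in> P; b \<in> P\<rbrakk> \<Longrightarrow> a - b \<in> P"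
proof -
  show neg: "- a \<in> P" if "a \<in> P" for a
    using assms that uminus_closed[OF one_closed] unfolding subideal_def
    by (metis mult_minus1)
  show "a - b \<in> P" if "a \<in> P" "b \<in> P" for a b
    using assms neg that unfolding subideal_def by (metis diff_conv_add_uminus)
qed (use assms in \<open>auto simp: subideal_def\<close>)

lemma subideal_carrier: "subideal C"
  using zero_closed add_closed mult_closed by (simp add: subideal_def)

lemma subideal_sum: "\<lbrakk>subideal P; \<And>i. i \<in> A \<Longrightarrow> f i \<in> P\<rbrakk> \<Longrightarrow> sum f A \<in> P"
  by (induction A rule: infinite_finite_induct) (auto simp: subidealD)

lemma span_closed: "y \<in> span \<Longrightarrow> y \<in> C"
  unfolding span_def by (auto intro!: subideal_sum[OF subideal_carrier] mult_closed x_closed)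

lemma koszul_sign_closed: "koszul_sign j \<sigma> \<in> C"
  unfolding koszul_sign_def using uminus_closed[OF one_closed] one_closed mult_closed
  by (induction "card {i \<in> \<sigma>. i < j}") (auto simp: minus_one_power_iff)

text \<open>Applied with \<open>P = C\<close> for well-definedness and with smaller \<open>P\<close>
  to see that congruences survive the differential.\<close>

lemma koszul_d_closed:
  assumes "subideal P" "\<sigma> \<subseteq> N" "\<And>\<tau>. \<lbrakk>\<tau> \<subseteq> N; Suc (card \<tau>) = card \<sigma>\<rbrakk> \<Longrightarrow> z \<tau> \<in> P"
  shows "koszul_d x z \<sigma> \<in> P"
  unfolding koszul_d_def
proof (rule subideal_sum[OF assms(1)])
  fix j assume j: "j \<in> \<sigma>"
  have "finite \<sigma>" using assms(2) finite_N finite_subset by blast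
  then have "z (\<sigma> - {j}) \<in> P" using j assms(2) card_Suc_Diff1[of \<sigma> j] by (intro assms(3)) auto
  then show "koszul_sign j \<sigma> * x j * z (\<sigma> - {j}) \<in> P"
    using j assms(1,2) koszul_sign_closed x_closed by (intro subidealD(4)[OF assms(1)] mult_closed) auto
qed

lemma koszul_homotopy_closed:
  assumes "subideal P" "\<sigma> \<subseteq> N" "a ` N \<subseteq> C" "\<And>\<tau>. \<lbrakk>\<tau> \<subseteq> N; card \<tau> = Suc (card \<sigma>)\<rbrakk> \<Longrightarrow> z \<tau> \<in> P"
  shows "koszul_homotopy N a z \<sigma> \<in> P"
  unfolding koszul_homotopy_def
proof (rule subideal_sum[OF assms(1)])
  fix j assume j: "j \<in> N - \<sigma>"
  have "finite \<sigma>" using assms(2) finite_N finite_subset by blast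
  then have "z (insert j \<sigma>) \<in> P" using j assms(2) by (intro assms(4)) auto
  then show "koszul_sign j \<sigma> * a j * z (insert j \<sigma>) \<in> P"
    using j assms(1,3) koszul_sign_closed by (intro subidealD(4)[OF assms(1)] mult_closed) auto
qed

lemma cohomology_vanishesE:
  assumes "cohomology_vanishes P i" "\<And>\<sigma>. \<sigma> \<subseteq> N \<Longrightarrow> z \<sigma> \<in> C"
    and "\<And>\<sigma>. \<lbrakk>\<sigma> \<subseteq> N; card \<sigma> = Suc i\<rbrakk> \<Longrightarrow> koszul_d x z \<sigma> \<in> P"
  obtains w where "w ` Pow N \<subseteq> C" "\<And>\<sigma>. \<lbrakk>\<sigma> \<subseteq> N; card \<sigma> = i\<rbrakk> \<Longrightarrow> z \<sigma> - koszul_d x w \<sigma> \<in> P"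
proof -
  have "z ` Pow N \<subseteq> C" using assms(2) by auto
  with assms(1,3) have "\<exists>w. w ` Pow N \<subseteq> C \<and> (\<forall>\<sigma>\<subseteq>N. card \<sigma> = i \<longrightarrow> z \<sigma> - koszul_d x w \<sigma> \<in> P)"
    unfolding cohomology_vanishes_def by simp
  with that show ?thesis by blast
qed

section \<open>Vanishing and nonvanishing along a regular chain\<close>

lemma regular_chain_Suc:
  "regular_chain P y (Suc e) \<Longrightarrow> regular_chain (\<lambda>i. P (Suc i)) (\<lambda>i. y (Suc i)) e"
  unfolding regular_chain_def by auto

text \<open>Elements of the span act as zero on Koszul cohomology, by \<open>koszul_homotopy\<close>.\<close>

lemma cohomology_vanishes_if_regular:
  assumes "regular_chain P y e" "i < e"
  shows "cohomology_vanishes (P 0) i"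
  using assms
proof (induction e arbitrary: P y i)
  case (Suc e)
  have P0: "subideal (P 0)" and P1: "subideal (P 1)" and y: "y 0 \<in> span"
    and nzd: "\<And>a. \<lbrakk>a \<in> C; y 0 * a \<in> P 0\<rbrakk> \<Longrightarrow> a \<in> P 0"
    and P1_eq: "P 1 = {p + y 0 * a | p a. p \<in> P 0 \<and> a \<in> C}"
    using Suc.prems(1) unfolding regular_chain_def regular_step_def by auto
  note yC = span_closed[OF y]
  obtain a where a: "a ` N \<subseteq> C" "y 0 = (\<Sum>j\<in>N. a j * x j)"
    using y by (auto simp: span_def)
  show ?case
    unfolding cohomology_vanishes_def
  proof (intro allI impI, elim conjE)
    fix z assume z: "z ` Pow N \<subseteq> C" and dz: "\<forall>\<sigma>\<subseteq>N. card \<sigma> = Suc i \<longrightarrow> koszul_d x z \<sigma> \<in> P 0"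
    \<comment> \<open>By the homotopy identity, \<open>y 0 * z\<close> is the coboundary of
      \<open>w\<close> modulo \<open>P 0\<close> in degree \<open>i\<close>. What remains is to
      divide by \<open>y 0\<close>.\<close>
    define w where "w = koszul_homotopy N a z"
    have w: "w \<sigma> \<in> C" if "\<sigma> \<subseteq> N" for \<sigma>
      using that a z unfolding w_def by (intro koszul_homotopy_closed[OF subideal_carrier]) auto
    have yz: "y 0 * z \<sigma> - koszul_d x w \<sigma> \<in> P 0" if "\<sigma> \<subseteq> N" "card \<sigma> = i" for \<sigma>
    proof -
      have "y 0 * z \<sigma> - koszul_d x w \<sigma> = koszul_homotopy N a (koszul_d x z) \<sigma>"
        using koszul_homotopy[OF finite_N that(1), of x a z] a by (simp add: w_def algebra_simps)
      then show ?thesis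
        using that a dz by (simp add: koszul_homotopy_closed[OF P0])
    qed
    show "\<exists>w. w ` Pow N \<subseteq> C \<and> (\<forall>\<sigma>\<subseteq>N. card \<sigma> = i \<longrightarrow> z \<sigma> - koszul_d x w \<sigma> \<in> P 0)"
    proof (cases i)
      case 0
      have "z \<sigma> - koszul_d x (\<lambda>_. 0) \<sigma> \<in> P 0" if "\<sigma> \<subseteq> N" "card \<sigma> = i" for \<sigma>
      proof -
        have "\<sigma> = {}" using that 0 finite_N finite_subset by fastforce
        then show ?thesis using yz[of \<sigma>] that z by (auto simp: koszul_d_def intro!: nzd)
      qed
      then show ?thesis using zero_closed by (intro exI[of _ "\<lambda>_. 0"]) auto
    next
      case (Suc i')
      \<comment> \<open>Modulo \<open>P 1\<close> the multiple \<open>y 0 * z\<close> dies, so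
        \<open>w\<close> is a cocycle one degree lower, where induction applies.\<close>
      have "cohomology_vanishes (P 1) i'"
        using Suc.IH[OF regular_chain_Suc[OF Suc.prems(1)]] Suc.prems(2) \<open>i = Suc i'\<close> by simp
      moreover have "koszul_d x w \<sigma> \<in> P 1" if "\<sigma> \<subseteq> N" "card \<sigma> = Suc i'" for \<sigma>
      proof -
        have "- (y 0 * z \<sigma> - koszul_d x w \<sigma>) \<in> P 0" "z \<sigma> \<in> C"
          using subidealD(5)[OF P0 yz[OF that(1)]] that Suc z by auto
        then show ?thesis unfolding P1_eq
          by (intro CollectI exI[of _ "- (y 0 * z \<sigma> - koszul_d x w \<sigma>)"] exI[of _ "z \<sigma>"]) simp
      qed
      ultimately obtain v where v: "v ` Pow N \<subseteq> C"
          and wv: "\<And>\<sigma>. \<lbrakk>\<sigma> \<subseteq> N; card \<sigma> = i'\<rbrakk> \<Longrightarrow> w \<sigma> - koszul_d x v \<sigma> \<in> P 1"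
        using cohomology_vanishesE[of "P 1" i' w] w by blast
      \<comment> \<open>Elements of \<open>P 1\<close> are multiples of \<open>y 0\<close> modulo
        \<open>P 0\<close>. The default zero in other degrees makes \<open>u\<close> a total
        function into \<open>C\<close>.\<close>
      have "\<exists>u\<in>C. \<sigma> \<subseteq> N \<and> card \<sigma> = i' \<longrightarrow> w \<sigma> - koszul_d x v \<sigma> - y 0 * u \<in> P 0" for \<sigma>
      proof (cases "\<sigma> \<subseteq> N \<and> card \<sigma> = i'")
        case True
        then obtain p u where "p \<in> P 0" "u \<in> C" "w \<sigma> - koszul_d x v \<sigma> = p + y 0 * u"
          using wv[of \<sigma>] unfolding P1_eq by blast
        then show ?thesis by (intro bexI[of _ u]) auto
      qed (use zero_closed in auto)
      then obtain u where u: "\<And>\<sigma>. u \<sigma> \<in> C"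
          and wu: "\<And>\<sigma>. \<lbrakk>\<sigma> \<subseteq> N; card \<sigma> = i'\<rbrakk> \<Longrightarrow> w \<sigma> - koszul_d x v \<sigma> - y 0 * u \<sigma> \<in> P 0"
        by metis
      have "z \<sigma> - koszul_d x u \<sigma> \<in> P 0" if \<sigma>: "\<sigma> \<subseteq> N" "card \<sigma> = i" for \<sigma>
      proof (rule nzd)
        have fin: "finite \<sigma>" using \<sigma> finite_N finite_subset by blast
        \<comment> \<open>The differential removes \<open>v\<close>, so \<open>koszul_d x w\<close>
          is congruent to \<open>y 0 * koszul_d x u\<close>; then \<open>y 0\<close>
          cancels.\<close>
        have "koszul_d x (\<lambda>\<sigma>. w \<sigma> - koszul_d x v \<sigma> - y 0 * u \<sigma>) \<sigma> \<in> P 0"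
          using \<sigma> Suc wu by (intro koszul_d_closed[OF P0]) auto
        also have "koszul_d x (\<lambda>\<sigma>. w \<sigma> - koszul_d x v \<sigma> - y 0 * u \<sigma>) \<sigma>
            = koszul_d x w \<sigma> - y 0 * koszul_d x u \<sigma>"
          by (simp add: koszul_d_diff koszul_d_scale koszul_d_d[OF fin])
        finally have "(y 0 * z \<sigma> - koszul_d x w \<sigma>) + (koszul_d x w \<sigma> - y 0 * koszul_d x u \<sigma>) \<in> P 0"
          using subidealD(3)[OF P0] yz[OF \<sigma>] by blast
        then show "y 0 * (z \<sigma> - koszul_d x u \<sigma>) \<in> P 0"
          by (simp add: right_diff_distrib)
        show "z \<sigma> - koszul_d x u \<sigma> \<in> C"
          using z \<sigma> u by (intro subidealD(6)[OF subideal_carrier] koszul_d_closed[OF subideal_carrier]) auto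
      qed
      then show ?thesis using u by (intro exI[of _ u]) auto
    qed
  qed
qed simp

text \<open>Modulo \<open>P d\<close>, the constant cochain \<open>u\<close> is a nonzero class of
  degree 0. Multiplication by \<open>y 0\<close> on \<open>C / P 0\<close> has cokernel
  \<open>C / P 1\<close>, and the connecting map from degree \<open>d\<close> over
  \<open>P 1\<close> to degree \<open>Suc d\<close> over \<open>P 0\<close> is injective because
  degree \<open>d\<close> over \<open>P 0\<close> vanishes.\<close>

lemma not_cohomology_vanishes_if_socle:
  assumes "regular_chain P y d" "u \<in> C" "u \<notin> P d" "\<And>j. j \<in> N \<Longrightarrow> x j * u \<in> P d"
  shows "\<not> cohomology_vanishes (P 0) d"
  using assms
proof (induction d arbitrary: P y)
  case 0
  show ?case
  proof
    assume H: "cohomology_vanishes (P 0) 0"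
    have du: "koszul_d x (\<lambda>_. u) \<sigma> \<in> P 0" if \<sigma>: "\<sigma> \<subseteq> N" "card \<sigma> = Suc 0" for \<sigma>
    proof -
      obtain j where j: "\<sigma> = {j}" using \<sigma>(2) by (metis One_nat_def card_1_singletonE)
      have "koszul_d x (\<lambda>_. u) \<sigma> = koszul_sign j {} * (x j * u)"
        by (simp add: koszul_d_def j koszul_sign_insert)
      then have "koszul_d x (\<lambda>_. u) \<sigma> = x j * u"
        by (simp add: koszul_sign_def)
      then show ?thesis using 0(4)[of j] \<sigma>(1) j by simp
    qed
    obtain w where "\<And>\<sigma>. \<lbrakk>\<sigma> \<subseteq> N; card \<sigma> = 0\<rbrakk> \<Longrightarrow> u - koszul_d x w \<sigma> \<in> P 0"
      by (rule cohomology_vanishesE[OF H, of "\<lambda>_. u"]) (use 0(2) du in auto)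
    from this[of "{}"] have "u - koszul_d x w {} \<in> P 0" by simp
    then show False using 0 by (simp add: koszul_d_def)
  qed
next
  case (Suc d)
  have P0: "subideal (P 0)" and P1: "subideal (P 1)" and y: "y 0 \<in> span"
    and nzd: "\<And>a. \<lbrakk>a \<in> C; y 0 * a \<in> P 0\<rbrakk> \<Longrightarrow> a \<in> P 0"
    and P1_eq: "P 1 = {p + y 0 * a | p a. p \<in> P 0 \<and> a \<in> C}"
    using Suc.prems(1) unfolding regular_chain_def regular_step_def by auto
  note yC = span_closed[OF y]
  note dC = koszul_d_closed[OF subideal_carrier]
  have "\<not> cohomology_vanishes (P 1) d"
    using Suc.IH[OF regular_chain_Suc[OF Suc.prems(1)]] Suc.prems by simp
  moreover have "cohomology_vanishes (P 1) d" if H: "cohomology_vanishes (P 0) (Suc d)"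
    unfolding cohomology_vanishes_def
  proof (intro allI impI, elim conjE)
    fix z assume z: "z ` Pow N \<subseteq> C" and dz: "\<forall>\<sigma>\<subseteq>N. card \<sigma> = Suc d \<longrightarrow> koszul_d x z \<sigma> \<in> P 1"
    \<comment> \<open>\<open>g\<close> represents the image of \<open>z\<close> under the connecting
      map: the coboundary of a lift, divided by \<open>y 0\<close>.\<close>
    have "\<exists>g\<in>C. \<sigma> \<subseteq> N \<and> card \<sigma> = Suc d \<longrightarrow> koszul_d x z \<sigma> - y 0 * g \<in> P 0" for \<sigma>
    proof (cases "\<sigma> \<subseteq> N \<and> card \<sigma> = Suc d")
      case True
      then obtain p g where "p \<in> P 0" "g \<in> C" "koszul_d x z \<sigma> = p + y 0 * g"
        using dz unfolding P1_eq by blast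
      then show ?thesis by (intro bexI[of _ g]) auto
    qed (use zero_closed in auto)
    then obtain g where g: "\<And>\<sigma>. g \<sigma> \<in> C"
        and zg: "\<And>\<sigma>. \<lbrakk>\<sigma> \<subseteq> N; card \<sigma> = Suc d\<rbrakk> \<Longrightarrow> koszul_d x z \<sigma> - y 0 * g \<sigma> \<in> P 0"
      by metis
    have "koszul_d x g \<sigma> \<in> P 0" if \<sigma>: "\<sigma> \<subseteq> N" "card \<sigma> = Suc (Suc d)" for \<sigma>
    proof (rule nzd)
      have fin: "finite \<sigma>" using \<sigma> finite_N finite_subset by blast
      show "koszul_d x g \<sigma> \<in> C" using g \<sigma> by (intro dC)
      have "koszul_d x (\<lambda>\<sigma>. koszul_d x z \<sigma> - y 0 * g \<sigma>) \<sigma> \<in> P 0"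
        using \<sigma> zg by (intro koszul_d_closed[OF P0]) auto
      then have "- (y 0 * koszul_d x g \<sigma>) \<in> P 0"
        by (simp add: koszul_d_diff koszul_d_scale koszul_d_d[OF fin])
      then show "y 0 * koszul_d x g \<sigma> \<in> P 0" using subidealD(5)[OF P0] by force
    qed
    then obtain w where w: "w ` Pow N \<subseteq> C"
        and gw: "\<And>\<sigma>. \<lbrakk>\<sigma> \<subseteq> N; card \<sigma> = Suc d\<rbrakk> \<Longrightarrow> g \<sigma> - koszul_d x w \<sigma> \<in> P 0"
      using cohomology_vanishesE[OF H, of g] g by blast
    \<comment> \<open>Subtracting \<open>y 0 * w\<close> changes nothing modulo \<open>P 1\<close>
      and makes \<open>z\<close> a cocycle modulo \<open>P 0\<close>.\<close>
    have "koszul_d x (\<lambda>\<sigma>. z \<sigma> - y 0 * w \<sigma>) \<sigma> \<in> P 0" if \<sigma>: "\<sigma> \<subseteq> N" "card \<sigma> = Suc d" for \<sigma>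
    proof -
      have "(koszul_d x z \<sigma> - y 0 * g \<sigma>) + y 0 * (g \<sigma> - koszul_d x w \<sigma>) \<in> P 0"
        by (rule subidealD(3)[OF P0 zg[OF \<sigma>] subidealD(4)[OF P0 gw[OF \<sigma>] yC]])
      then show ?thesis by (simp add: koszul_d_diff koszul_d_scale right_diff_distrib)
    qed
    moreover have "z \<sigma> - y 0 * w \<sigma> \<in> C" if "\<sigma> \<subseteq> N" for \<sigma>
      using that z w yC by (intro subidealD(6)[OF subideal_carrier] mult_closed) auto
    moreover have "cohomology_vanishes (P 0) d"
      using cohomology_vanishes_if_regular[OF Suc.prems(1)] by simp
    ultimately obtain v where v: "v ` Pow N \<subseteq> C"
        and zv: "\<And>\<sigma>. \<lbrakk>\<sigma> \<subseteq> N; card \<sigma> = d\<rbrakk> \<Longrightarrow> z \<sigma> - y 0 * w \<sigma> - koszul_d x v \<sigma> \<in> P 0"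
      using cohomology_vanishesE[of "P 0" d "\<lambda>\<sigma>. z \<sigma> - y 0 * w \<sigma>"] by blast
    have "z \<sigma> - koszul_d x v \<sigma> \<in> P 1" if "\<sigma> \<subseteq> N" "card \<sigma> = d" for \<sigma>
      unfolding P1_eq
      using zv[OF that] w that by (intro CollectI exI[of _ "z \<sigma> - y 0 * w \<sigma> - koszul_d x v \<sigma>"] exI[of _ "w \<sigma>"]) auto
    with v show "\<exists>w. w ` Pow N \<subseteq> C \<and> (\<forall>\<sigma>\<subseteq>N. card \<sigma> = d \<longrightarrow> z \<sigma> - koszul_d x w \<sigma> \<in> P 1)"
      by blast
  qed
  ultimately show ?case by blast
qed

text \<open>\<open>H^d\<close> over the common first ideal is nonzero because of \<open>u\<close>,
  whereas a chain with \<open>e > d\<close> would make it zero.\<close>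

theorem regular_chain_length_le:
  assumes "regular_chain P y d" "u \<in> C" "u \<notin> P d" "\<And>j. j \<in> N \<Longrightarrow> x j * u \<in> P d"
    and "regular_chain Q y' e" "Q 0 = P 0"
  shows "e \<le> d"
  using not_cohomology_vanishes_if_socle[OF assms(1-4)] cohomology_vanishes_if_regular[OF assms(5)] assms(6)
  by (metis not_less)

end

section \<open>Depth over a polynomial ring\<close>

lemma (in cring) genideal_insert:
  assumes A: "A \<subseteq> carrier R" and y: "y \<in> carrier R"
  shows "Idl (insert y A) = {p \<oplus> y \<otimes> a | p a. a \<in> carrier R \<and> p \<in> Idl A}"
proof -
  interpret I: ideal "Idl A" R using A by (rule genideal_ideal)
  have yA: "insert y A \<subseteq> carrier R" using A y by simp
  interpret K: ideal "Idl (insert y A)" R using yA by (rule genideal_ideal)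
  have "ideal (Idl A <+> PIdl y) R"
    by (intro add_ideals I.is_ideal cgenideal_ideal y)
  moreover have eq: "Idl A <+> PIdl y = {p \<oplus> y \<otimes> a | p a. a \<in> carrier R \<and> p \<in> Idl A}"
  proof -
    have "PIdl y = {y \<otimes> a | a. a \<in> carrier R}"
      unfolding cgenideal_def using m_comm[OF y] by metis
    then show ?thesis unfolding set_add_defs by auto
  qed
  ultimately have id: "ideal {p \<oplus> y \<otimes> a | p a. a \<in> carrier R \<and> p \<in> Idl A} R"
    by simp
  show ?thesis
  proof
    have "b \<in> {p \<oplus> y \<otimes> a | p a. a \<in> carrier R \<and> p \<in> Idl A}" if "b \<in> A" for b
    proof -
      have "b = b \<oplus> y \<otimes> \<zero>" "b \<in> Idl A" using that A y genideal_self[OF A] by auto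
      then show ?thesis by blast
    qed
    moreover have "y = \<zero> \<oplus> y \<otimes> \<one>" using y by simp
    then have "y \<in> {p \<oplus> y \<otimes> a | p a. a \<in> carrier R \<and> p \<in> Idl A}"
      using I.zero_closed one_closed by blast
    ultimately show "Idl (insert y A) \<subseteq> {p \<oplus> y \<otimes> a | p a. a \<in> carrier R \<and> p \<in> Idl A}"
      by (intro genideal_minimal[OF id]) blast
  next
    have "p \<in> Idl (insert y A)" if "p \<in> Idl A" for p
      using that genideal_minimal[OF K.is_ideal, of A] genideal_self[OF yA] by auto
    moreover have "y \<in> Idl (insert y A)" using genideal_self[OF yA] by auto
    ultimately show "{p \<oplus> y \<otimes> a | p a. a \<in> carrier R \<and> p \<in> Idl A} \<subseteq> Idl (insert y A)"
      using K.I_r_closed K.a_closed by blast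
  qed
qed

lemma poly_ring_simps [simp]:
  "mult (poly_ring n) = (*)" "add (poly_ring n) = (+)" "one (poly_ring n) = 1" "zero (poly_ring n) = 0"
  by (simp_all add: poly_ring_def)

lemma carrier_poly_ring_iff:
  "p \<in> carrier (poly_ring n) \<longleftrightarrow> (\<forall>m \<in> Poly_Mapping.keys p. Poly_Mapping.keys m \<subseteq> {..<n})"
  by (simp add: poly_ring_def)

definition Var :: "nat \<Rightarrow> (nat \<Rightarrow>\<^sub>0 nat) \<Rightarrow>\<^sub>0 'k::field"
  where "Var i = Poly_Mapping.single (Poly_Mapping.single i 1) 1"

lemma Var_in_carrier: "i < n \<Longrightarrow> Var i \<in> carrier (poly_ring n)"
  by (simp add: carrier_poly_ring_iff Var_def)

lemma graded_maximal_ideal_eq: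
  "graded_maximal_ideal n = genideal (poly_ring n) {Var i | i. i < n}"
  by (simp add: graded_maximal_ideal_def Var_def)

lemma uminus_in_carrier: "p \<in> carrier (poly_ring n) \<Longrightarrow> - p \<in> carrier (poly_ring n)"
  by (simp add: poly_ring_def)

interpretation poly: cring "poly_ring n :: ((nat \<Rightarrow>\<^sub>0 nat) \<Rightarrow>\<^sub>0 'k::field) ring" for n
  by (rule cring_poly_ring)

lemmas poly_closed = poly.add.m_closed[simplified] poly.m_closed[simplified]
  poly.zero_closed[simplified] poly.one_closed[simplified] uminus_in_carrier

interpretation poly_koszul: koszul "carrier (poly_ring n :: ((nat \<Rightarrow>\<^sub>0 nat) \<Rightarrow>\<^sub>0 'k::field) ring)" Var "{..<n}" for n
  by unfold_locales (auto simp: Var_in_carrier intro: poly_closed)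

text \<open>Lets ideals be handled with the arithmetic of the type; only the additive inverse of the
  record has to be identified with \<open>-\<close>.\<close>

lemma ideal_poly_ring_iff:
  fixes P :: "((nat \<Rightarrow>\<^sub>0 nat) \<Rightarrow>\<^sub>0 'k::field) set"
  shows "ideal P (poly_ring n) \<longleftrightarrow> poly_koszul.subideal n P"
proof
  assume "ideal P (poly_ring n)"
  then interpret P: ideal P "poly_ring n" .
  show "poly_koszul.subideal n P"
    unfolding poly_koszul.subideal_def
    using P.Icarr P.zero_closed P.a_closed P.I_l_closed by auto
next
  assume P: "poly_koszul.subideal n P"
  note D = poly_koszul.subidealD[OF P]
  show "ideal P (poly_ring n)"
  proof (rule idealI)
    show "ring (poly_ring n :: ((nat \<Rightarrow>\<^sub>0 nat) \<Rightarrow>\<^sub>0 'k) ring)" by (rule poly.ring_axioms)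
    have neg: "\<ominus>\<^bsub>poly_ring n\<^esub> a = - a" if "a \<in> P" for a
      using that D(1) by (intro poly.minus_equality) (auto simp: uminus_in_carrier)
    show "subgroup P (add_monoid (poly_ring n))"
    proof (rule subgroup.intro)
      show "inv\<^bsub>add_monoid (poly_ring n)\<^esub> a \<in> P" if "a \<in> P" for a
        using neg[OF that] D(5)[OF that] by (simp only: a_inv_def)
    qed (use D in auto)
  qed (use D in \<open>auto simp: mult.commute\<close>)
qed

lemma span_eq_graded_maximal_ideal:
  "poly_koszul.span n = (graded_maximal_ideal n :: ((nat \<Rightarrow>\<^sub>0 nat) \<Rightarrow>\<^sub>0 'k::field) set)"
proof
  let ?G = "{Var i | i. i < n} :: ((nat \<Rightarrow>\<^sub>0 nat) \<Rightarrow>\<^sub>0 'k) set"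
  have id: "poly_koszul.subideal n (graded_maximal_ideal n :: ((nat \<Rightarrow>\<^sub>0 nat) \<Rightarrow>\<^sub>0 'k) set)"
    using ideal_graded_maximal_ideal ideal_poly_ring_iff by blast
  have G: "?G \<subseteq> carrier (poly_ring n)"
    using Var_in_carrier by blast
  show "poly_koszul.span n \<subseteq> (graded_maximal_ideal n :: ((nat \<Rightarrow>\<^sub>0 nat) \<Rightarrow>\<^sub>0 'k) set)"
  proof
    fix y :: "(nat \<Rightarrow>\<^sub>0 nat) \<Rightarrow>\<^sub>0 'k" assume "y \<in> poly_koszul.span n"
    then obtain a where a: "a ` {..<n} \<subseteq> carrier (poly_ring n)" "y = (\<Sum>j<n. a j * Var j)"
      by (auto simp: poly_koszul.span_def)
    have "a j * Var j \<in> graded_maximal_ideal n" if "j < n" for j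
      using that a(1) poly.genideal_self[OF G]
      by (intro poly_koszul.subidealD(4)[OF id]) (auto simp: graded_maximal_ideal_eq)
    then show "y \<in> graded_maximal_ideal n"
      unfolding a(2) by (intro poly_koszul.subideal_sum[OF id]) auto
  qed
  have "poly_koszul.subideal n (poly_koszul.span n :: ((nat \<Rightarrow>\<^sub>0 nat) \<Rightarrow>\<^sub>0 'k) set)"
    unfolding poly_koszul.subideal_def
  proof (intro conjI ballI)
    show "poly_koszul.span n \<subseteq> (carrier (poly_ring n) :: ((nat \<Rightarrow>\<^sub>0 nat) \<Rightarrow>\<^sub>0 'k) set)"
      using poly_koszul.span_closed by blast
    show "(0 :: (nat \<Rightarrow>\<^sub>0 nat) \<Rightarrow>\<^sub>0 'k) \<in> poly_koszul.span n"
      unfolding poly_koszul.span_def by (intro CollectI exI[of _ "\<lambda>_. 0"]) (auto simp: poly_closed)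
    fix p :: "(nat \<Rightarrow>\<^sub>0 nat) \<Rightarrow>\<^sub>0 'k" assume "p \<in> poly_koszul.span n"
    then obtain a where a: "a ` {..<n} \<subseteq> carrier (poly_ring n)" "p = (\<Sum>j<n. a j * Var j)"
      by (auto simp: poly_koszul.span_def)
    show "p + q \<in> poly_koszul.span n" if q: "q \<in> poly_koszul.span n" for q
    proof -
      obtain b where b: "b ` {..<n} \<subseteq> carrier (poly_ring n)" "q = (\<Sum>j<n. b j * Var j)"
        using q by (auto simp: poly_koszul.span_def)
      show ?thesis
        unfolding poly_koszul.span_def a(2) b(2) using a(1) b(1)
        by (intro CollectI exI[of _ "\<lambda>j. a j + b j"])
           (auto simp: distrib_right sum.distrib intro: poly_closed)
    qed
    show "c * p \<in> poly_koszul.span n" if "c \<in> carrier (poly_ring n)" for c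
      unfolding poly_koszul.span_def a(2) using a(1) that
      by (intro CollectI exI[of _ "\<lambda>j. c * a j"])
         (auto simp: sum_distrib_left mult.assoc intro: poly_closed)
  qed
  then have "ideal (poly_koszul.span n :: ((nat \<Rightarrow>\<^sub>0 nat) \<Rightarrow>\<^sub>0 'k) set) (poly_ring n)"
    by (simp add: ideal_poly_ring_iff)
  moreover have "Var i \<in> (poly_koszul.span n :: ((nat \<Rightarrow>\<^sub>0 nat) \<Rightarrow>\<^sub>0 'k) set)" if "i < n" for i
    unfolding poly_koszul.span_def using that
    by (intro CollectI exI[of _ "\<lambda>j. if j = i then 1 else 0"])
       (auto simp: if_distrib[of "\<lambda>x. x * _"] poly_closed cong: if_cong)
  ultimately show "(graded_maximal_ideal n :: ((nat \<Rightarrow>\<^sub>0 nat) \<Rightarrow>\<^sub>0 'k) set) \<subseteq> poly_koszul.span n"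
    unfolding graded_maximal_ideal_eq by (intro poly.genideal_minimal) auto
qed

text \<open>Used twice: for the regular sequence that is constructed and for an arbitrary competing
  one.\<close>

lemma regular_chain_genideal:
  fixes J :: "((nat \<Rightarrow>\<^sub>0 nat) \<Rightarrow>\<^sub>0 'k::field) set"
  assumes J: "ideal J (poly_ring n)" and ys: "set ys \<subseteq> graded_maximal_ideal n"
    and nzd: "\<And>i a. \<lbrakk>i < length ys; a \<in> carrier (poly_ring n);
      ys ! i * a \<in> genideal (poly_ring n) (J \<union> set (take i ys))\<rbrakk>
      \<Longrightarrow> a \<in> genideal (poly_ring n) (J \<union> set (take i ys))"
  shows "poly_koszul.regular_chain n (\<lambda>i. genideal (poly_ring n) (J \<union> set (take i ys))) ((!) ys) (length ys)"
proof -
  have ysC: "set ys \<subseteq> carrier (poly_ring n)"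
    using ys poly_koszul.span_closed span_eq_graded_maximal_ideal by blast
  have sub: "J \<union> set (take i ys) \<subseteq> carrier (poly_ring n)" for i
    using ysC set_take_subset[of i ys] ideal.Icarr[OF J] by blast
  have "genideal (poly_ring n) (J \<union> set (take (Suc i) ys))
      = {p + ys ! i * a | p a. a \<in> carrier (poly_ring n) \<and> p \<in> genideal (poly_ring n) (J \<union> set (take i ys))}"
    if "i < length ys" for i
  proof -
    have "J \<union> set (take (Suc i) ys) = insert (ys ! i) (J \<union> set (take i ys))"
      using that by (simp add: take_Suc_conv_app_nth)
    moreover have "ys ! i \<in> carrier (poly_ring n)" using that ysC by auto
    ultimately show ?thesis using poly.genideal_insert[OF sub, of "ys ! i" i] by simp
  qed
  then show ?thesis
    unfolding poly_koszul.regular_chain_def poly_koszul.regular_step_def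
    using nzd ys poly.genideal_ideal[OF sub]
    by (auto simp: span_eq_graded_maximal_ideal simp flip: ideal_poly_ring_iff)
qed

text \<open>The sequence \<open>ys\<close> bounds the depth from below. The socle element
  \<open>u\<close> modulo \<open>J\<close> and \<open>ys\<close> makes Koszul cohomology in degree
  \<open>length ys\<close> nonzero, which bounds every regular sequence from above.\<close>

lemma depth_quotient_eqI:
  fixes J :: "((nat \<Rightarrow>\<^sub>0 nat) \<Rightarrow>\<^sub>0 'k::field) set"
  assumes J: "ideal J (poly_ring n)" and ys: "set ys \<subseteq> graded_maximal_ideal n"
    and nzd: "\<And>i a. \<lbrakk>i < length ys; a \<in> carrier (poly_ring n);
      ys ! i * a \<in> genideal (poly_ring n) (J \<union> set (take i ys))\<rbrakk>
      \<Longrightarrow> a \<in> genideal (poly_ring n) (J \<union> set (take i ys))"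
    and u: "u \<in> carrier (poly_ring n)" "u \<notin> genideal (poly_ring n) (J \<union> set ys)"
      "\<And>i. i < n \<Longrightarrow> Var i * u \<in> genideal (poly_ring n) (J \<union> set ys)"
  shows "depth (poly_ring n) (graded_maximal_ideal n) (quotient_module (poly_ring n) J)
    = enat (length ys)"
proof -
  let ?m = "graded_maximal_ideal n :: ((nat \<Rightarrow>\<^sub>0 nat) \<Rightarrow>\<^sub>0 'k) set"
  let ?I = "genideal (poly_ring n) (J \<union> set ys)"
  have chain: "poly_koszul.regular_chain n (\<lambda>i. genideal (poly_ring n) (J \<union> set (take i ys)))
      ((!) ys) (length ys)"
    by (rule regular_chain_genideal[OF J ys]) (fact nzd)
  have mC: "?m \<subseteq> carrier (poly_ring n)"
    by (auto intro: ideal.Icarr[OF ideal_graded_maximal_ideal])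
  have sub: "J \<union> ?m \<subseteq> carrier (poly_ring n)" "J \<union> set ys \<subseteq> carrier (poly_ring n)"
    using ys mC by (auto intro: ideal.Icarr[OF J])
  have I: "poly_koszul.subideal n ?I"
    using poly.genideal_ideal[OF sub(2)] ideal_poly_ring_iff by blast
  \<comment> \<open>The annihilator of \<open>u\<close> modulo \<open>?I\<close> contains
    \<open>J\<close> and all variables, but not 1. This excludes the infinite value of
    \<open>depth\<close>.\<close>
  have "genideal (poly_ring n) (J \<union> ?m) \<subseteq> {a \<in> carrier (poly_ring n). a * u \<in> ?I}"
  proof (rule poly.genideal_minimal)
    show id: "ideal {a \<in> carrier (poly_ring n). a * u \<in> ?I} (poly_ring n)"
      unfolding ideal_poly_ring_iff poly_koszul.subideal_def
      using poly_koszul.subidealD[OF I] by (auto simp: distrib_right mult.assoc intro: poly_closed)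
    have "?m \<subseteq> {a \<in> carrier (poly_ring n). a * u \<in> ?I}"
      unfolding graded_maximal_ideal_eq
      by (rule poly.genideal_minimal[OF id]) (use u(3) Var_in_carrier in auto)
    moreover have "a * u \<in> ?I" if "a \<in> J" for a
      using that poly.genideal_self[OF sub(2)] poly_koszul.subidealD(4)[OF I, of a u] u(1)
      by (auto simp: mult.commute)
    ultimately show "J \<union> ?m \<subseteq> {a \<in> carrier (poly_ring n). a * u \<in> ?I}"
      using sub(1) by blast
  qed
  then have proper: "genideal (poly_ring n) (J \<union> ?m) \<noteq> carrier (poly_ring n)"
    using u(2) poly.one_closed[of n] by auto
  have "regular_sequence (poly_ring n) (quotient_module (poly_ring n) J) ys"
    unfolding poly.regular_sequence_quotient_iff[OF J]
    using ys mC nzd u by auto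
  moreover have "length zs \<le> length ys"
    if zs: "regular_sequence (poly_ring n) (quotient_module (poly_ring n) J) zs" "set zs \<subseteq> ?m" for zs
  proof (rule poly_koszul.regular_chain_length_le[OF chain u(1)])
    show "poly_koszul.regular_chain n (\<lambda>i. genideal (poly_ring n) (J \<union> set (take i zs))) ((!) zs) (length zs)"
      using zs unfolding poly.regular_sequence_quotient_iff[OF J]
      by (intro regular_chain_genideal[OF J]) auto
  qed (use u in auto)
  ultimately have "Sup {enat (length xs) | xs.
      regular_sequence (poly_ring n) (quotient_module (poly_ring n) J) xs \<and> set xs \<subseteq> ?m} = enat (length ys)"
    using ys by (intro antisym Sup_least Sup_upper) auto
  then show ?thesis
    unfolding depth_def using proper poly.set_smult_module_eq_carrier_iff[OF J mC] by simp
qed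

section \<open>Monomial ideals and identification of variables\<close>

definition push :: "('a \<Rightarrow> 'b) \<Rightarrow> ('a \<Rightarrow>\<^sub>0 'c::comm_monoid_add) \<Rightarrow> ('b \<Rightarrow>\<^sub>0 'c)"
  where "push h p = (\<Sum>m\<in>Poly_Mapping.keys p. Poly_Mapping.single (h m) (Poly_Mapping.lookup p m))"

text \<open>Keys can cancel in a sum, so \<open>p\<close>, \<open>q\<close> and \<open>p + q\<close>
  are compared over one common index set.\<close>

lemma push_eq_sum:
  assumes "finite A" "Poly_Mapping.keys p \<subseteq> A"
  shows "push h p = (\<Sum>m\<in>A. Poly_Mapping.single (h m) (Poly_Mapping.lookup p m))"
  unfolding push_def using assms
  by (intro sum.mono_neutral_left) (auto simp: in_keys_iff)

lemma push_zero [simp]: "push h 0 = 0"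
  by (simp add: push_def)

lemma push_add: "push h (p + q) = push h p + push h q"
proof -
  let ?A = "Poly_Mapping.keys p \<union> Poly_Mapping.keys q"
  have "push h r = (\<Sum>m\<in>?A. Poly_Mapping.single (h m) (Poly_Mapping.lookup r m))"
    if "r \<in> {p, q, p + q}" for r
    using that Poly_Mapping.keys_add[of p q] by (intro push_eq_sum) auto
  then show ?thesis
    by (simp add: lookup_add single_add sum.distrib)
qed

lemma push_uminus: "push h (- p) = - push h (p :: _ \<Rightarrow>\<^sub>0 _::ab_group_add)"
  using push_add[of h p "- p"] by (simp add: eq_neg_iff_add_eq_0 add.commute)

lemma push_diff: "push h (p - q) = push h p - push h (q :: _ \<Rightarrow>\<^sub>0 _::ab_group_add)"
  using push_add[of h p "- q"] by (simp add: push_uminus)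

lemma push_sum: "push h (sum f A) = (\<Sum>i\<in>A. push h (f i))"
  by (induction A rule: infinite_finite_induct) (auto simp: push_add)

lemma push_single [simp]: "push h (Poly_Mapping.single m c) = Poly_Mapping.single (h m) c"
  by (cases "c = 0") (simp_all add: push_def)

lemma sum_single: "(\<Sum>m\<in>Poly_Mapping.keys p. Poly_Mapping.single m (Poly_Mapping.lookup p m)) = p"
  by (rule poly_mapping_eqI)
     (auto simp: lookup_sum lookup_single when_def in_keys_iff sum.delta)

lemma push_id [simp]: "push (\<lambda>m. m) p = p"
  by (simp add: push_def sum_single)

lemma keys_push: "Poly_Mapping.keys (push h p) \<subseteq> h ` Poly_Mapping.keys p"
  unfolding push_def
  by (rule order.trans[OF Poly_Mapping.keys_sum]) (auto split: if_splits)

lemma lookup_push: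
  "Poly_Mapping.lookup (push h p) i
    = (\<Sum>m\<in>Poly_Mapping.keys p. if h m = i then Poly_Mapping.lookup p m else 0)"
  by (simp add: push_def lookup_sum lookup_single when_def)

lemma lookup_push_inj:
  assumes "inj h"
  shows "Poly_Mapping.lookup (push h p) (h m) = Poly_Mapping.lookup p m"
  using assms by (auto simp: lookup_push inj_eq in_keys_iff sum.delta)

text \<open>An additive map of exponents thus induces a ring homomorphism. \<open>push\<close>
  serves on two levels, from variable indices to exponent vectors and from exponent vectors to
  polynomials.\<close>

lemma push_mult:
  assumes "\<And>a b. h (a + b) = h a + h b"
  shows "push h (p * q) = push h p * push h (q :: _ \<Rightarrow>\<^sub>0 _::semiring_0)"
proof -
  have "push h (p * q) = push h
    ((\<Sum>a\<in>Poly_Mapping.keys p. Poly_Mapping.single a (Poly_Mapping.lookup p a))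
      * (\<Sum>b\<in>Poly_Mapping.keys q. Poly_Mapping.single b (Poly_Mapping.lookup q b)))"
    by (simp only: sum_single)
  also have "\<dots> = push h p * push h q"
    by (simp add: push_def[of h p] push_def[of h q] sum_product push_sum mult_single assms)
  finally show ?thesis .
qed

lemma single_mult_eq_push: "Poly_Mapping.single m 1 * p = push ((+) m) (p :: _ \<Rightarrow>\<^sub>0 _::semiring_1)"
proof -
  have "Poly_Mapping.single m 1 * p = Poly_Mapping.single m 1
      * (\<Sum>b\<in>Poly_Mapping.keys p. Poly_Mapping.single b (Poly_Mapping.lookup p b))"
    by (simp only: sum_single)
  then show ?thesis by (simp add: sum_distrib_left mult_single push_def)
qed

text \<open>The coefficient of \<open>X^a * p\<close> at \<open>a + m\<close> is nonzero; if it does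
  not survive, a term of \<open>X^b * p\<close> must cancel it.\<close>

lemma in_keys_single_mult_diff:
  fixes p :: "(_::cancel_comm_monoid_add) \<Rightarrow>\<^sub>0 _::ring_1"
  assumes m: "m \<in> Poly_Mapping.keys p"
    and a: "a + m \<notin> Poly_Mapping.keys ((Poly_Mapping.single a 1 - Poly_Mapping.single b 1) * p)"
  obtains m' where "m' \<in> Poly_Mapping.keys p" "a + m = b + m'"
proof -
  have "Poly_Mapping.lookup (Poly_Mapping.single a 1 * p) (a + m) = Poly_Mapping.lookup p m"
    by (simp add: single_mult_eq_push lookup_push_inj inj_on_def)
  then have "Poly_Mapping.lookup (Poly_Mapping.single b 1 * p) (a + m) \<noteq> 0"
    using a m by (auto simp: in_keys_iff left_diff_distrib lookup_minus)
  then show thesis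
    using that keys_push[of "(+) b" p] by (auto simp: single_mult_eq_push simp flip: in_keys_iff)
qed

text \<open>
  For a monomial ideal \<open>D\<close>, this says that \<open>X\<^sub>v - X\<^sub>w\<close> is a nonzerodivisor modulo \<open>D\<close> if
  \<open>(D : X\<^sub>v) \<inter> (D : X\<^sub>w\<^sup>\<infinity>) = D\<close>.
\<close>

lemma keys_subset_if_Var_diff_mult:
  fixes p :: "(nat \<Rightarrow>\<^sub>0 nat) \<Rightarrow>\<^sub>0 'k::field"
  assumes vw: "v \<noteq> w"
    and keys: "Poly_Mapping.keys ((Var v - Var w) * p) \<subseteq> D"
    and closed: "\<And>e. e \<in> D \<Longrightarrow> Poly_Mapping.single v 1 + e \<in> D"
      "\<And>e. e \<in> D \<Longrightarrow> Poly_Mapping.single w 1 + e \<in> D"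
    and colon: "\<And>e N. \<lbrakk>Poly_Mapping.single v 1 + e \<in> D; Poly_Mapping.single w N + e \<in> D\<rbrakk> \<Longrightarrow> e \<in> D"
  shows "Poly_Mapping.keys p \<subseteq> D"
proof -
  \<comment> \<open>First stage: each exponent of \<open>p\<close> enters \<open>D\<close> after
    enough factors \<open>X_w\<close>. If \<open>X_w X^e\<close> is outside \<open>D\<close>, it
    cancels against some \<open>X_v X^e'\<close>, and \<open>e'\<close> has a smaller
    \<open>v\<close>-exponent.\<close>
  have ex: "\<exists>N. Poly_Mapping.single w N + e \<in> D" if "e \<in> Poly_Mapping.keys p" for e
    using that
  proof (induction "Poly_Mapping.lookup e v" arbitrary: e rule: less_induct)
    case less
    show ?case
    proof (cases "Poly_Mapping.single w 1 + e \<in> D")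
      case False
      have "Poly_Mapping.keys ((Var w - Var v) * p) = Poly_Mapping.keys (- ((Var v - Var w) * p))"
        by (simp add: left_diff_distrib)
      then have "Poly_Mapping.single w 1 + e \<notin> Poly_Mapping.keys ((Var w - Var v) * p)"
        using False keys by auto
      then obtain e' where e': "e' \<in> Poly_Mapping.keys p"
          "Poly_Mapping.single w 1 + e = Poly_Mapping.single v 1 + e'"
        unfolding Var_def using in_keys_single_mult_diff[OF less.prems] by metis
      have "Poly_Mapping.lookup e' v < Poly_Mapping.lookup e v"
        using arg_cong[OF e'(2), of "\<lambda>m. Poly_Mapping.lookup m v"] vw
        by (simp add: lookup_add lookup_single)
      then obtain N where "Poly_Mapping.single w N + e' \<in> D"
        using less.hyps e'(1) by blast
      then have "Poly_Mapping.single v 1 + (Poly_Mapping.single w N + e') \<in> D"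
        by (rule closed(1))
      also have "Poly_Mapping.single v 1 + (Poly_Mapping.single w N + e')
          = Poly_Mapping.single w N + (Poly_Mapping.single w 1 + e)"
        unfolding e'(2) by (simp add: ac_simps)
      also have "\<dots> = Poly_Mapping.single w (N + 1) + e"
        by (simp only: single_add add.assoc)
      finally show ?thesis by blast
    qed blast
  qed
  \<comment> \<open>Second stage, by induction on the \<open>w\<close>-exponent: if
    \<open>X_v X^e\<close> were outside \<open>D\<close>, it would cancel against some
    \<open>X_w X^e'\<close> with \<open>e'\<close> already in \<open>D\<close>. Then
    \<open>colon\<close> combines both stages.\<close>
  have "e \<in> D" if "e \<in> Poly_Mapping.keys p" for e
    using that
  proof (induction "Poly_Mapping.lookup e w" arbitrary: e rule: less_induct)
    case less
    have "Poly_Mapping.single v 1 + e \<in> D"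
    proof (rule ccontr)
      assume notD: "Poly_Mapping.single v 1 + e \<notin> D"
      then have "Poly_Mapping.single v 1 + e \<notin> Poly_Mapping.keys ((Var v - Var w) * p)"
        using keys by auto
      then obtain e' where e': "e' \<in> Poly_Mapping.keys p"
          "Poly_Mapping.single v 1 + e = Poly_Mapping.single w 1 + e'"
        unfolding Var_def using in_keys_single_mult_diff[OF less.prems] by metis
      have "Poly_Mapping.lookup e' w < Poly_Mapping.lookup e w"
        using arg_cong[OF e'(2), of "\<lambda>m. Poly_Mapping.lookup m w"] vw
        by (simp add: lookup_add lookup_single)
      then have "e' \<in> D" using less.hyps e'(1) by blast
      then show False using closed(2) e'(2) notD by simp
    qed
    then show ?case using ex[OF less.prems] colon by blast
  qed
  then show ?thesis by blast
qed

section \<open>Monomial ideals as sets of exponents\<close>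

definition expos :: "nat \<Rightarrow> (nat \<Rightarrow>\<^sub>0 nat) set"
  where "expos n = {m. Poly_Mapping.keys m \<subseteq> {..<n}}"

definition upclosed :: "nat \<Rightarrow> (nat \<Rightarrow>\<^sub>0 nat) set \<Rightarrow> bool"
  where "upclosed n D \<longleftrightarrow> D \<subseteq> expos n \<and> (\<forall>d\<in>D. \<forall>m\<in>expos n. m + d \<in> D)"

definition supported :: "(nat \<Rightarrow>\<^sub>0 nat) set \<Rightarrow> ((nat \<Rightarrow>\<^sub>0 nat) \<Rightarrow>\<^sub>0 'k::field) set"
  where "supported D = {p. Poly_Mapping.keys p \<subseteq> D}"

lemma zero_expos [simp]: "0 \<in> expos n"
  by (simp add: expos_def)

lemma expos_add: "\<lbrakk>a \<in> expos n; b \<in> expos n\<rbrakk> \<Longrightarrow> a + b \<in> expos n"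
  using Poly_Mapping.keys_add[of a b] by (auto simp: expos_def)

lemma carrier_poly_ring_eq: "carrier (poly_ring n) = supported (expos n)"
  unfolding poly_ring_def supported_def expos_def by (simp add: subset_eq)

lemma single_in_carrier: "m \<in> expos n \<Longrightarrow> Poly_Mapping.single m c \<in> carrier (poly_ring n)"
  by (auto simp: carrier_poly_ring_iff expos_def)

lemma subideal_supported:
  assumes "upclosed n D"
  shows "poly_koszul.subideal n (supported D :: ((nat \<Rightarrow>\<^sub>0 nat) \<Rightarrow>\<^sub>0 'k::field) set)"
  unfolding poly_koszul.subideal_def
proof (intro conjI ballI)
  show "(supported D :: ((nat \<Rightarrow>\<^sub>0 nat) \<Rightarrow>\<^sub>0 'k) set) \<subseteq> carrier (poly_ring n)"
    using assms by (auto simp: upclosed_def supported_def carrier_poly_ring_eq)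
  show "(0 :: (nat \<Rightarrow>\<^sub>0 nat) \<Rightarrow>\<^sub>0 'k) \<in> supported D"
    by (simp add: supported_def)
  fix p :: "(nat \<Rightarrow>\<^sub>0 nat) \<Rightarrow>\<^sub>0 'k" assume p: "p \<in> supported D"
  show "p + q \<in> supported D" if "q \<in> supported D" for q
    using that p Poly_Mapping.keys_add[of p q] by (auto simp: supported_def)
  show "c * p \<in> supported D" if c: "c \<in> carrier (poly_ring n)" for c
  proof -
    have "m \<in> D" if m: "m \<in> Poly_Mapping.keys (c * p)" for m
    proof -
      obtain a b where ab: "m = a + b" "a \<in> Poly_Mapping.keys c" "b \<in> Poly_Mapping.keys p"
        using m Poly_Mapping.keys_mult[of c p] by blast
      have "a \<in> expos n" "b \<in> D"
        using ab c p unfolding carrier_poly_ring_eq supported_def by blast+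
      then show ?thesis using ab(1) assms by (simp add: upclosed_def)
    qed
    then show ?thesis by (auto simp: supported_def)
  qed
qed

lemma subideal_mem_if_monomials:
  assumes "poly_koszul.subideal n P"
    and "\<And>m. m \<in> Poly_Mapping.keys p \<Longrightarrow> Poly_Mapping.single m (Poly_Mapping.lookup p m) \<in> P"
  shows "p \<in> P"
proof -
  have "(\<Sum>m\<in>Poly_Mapping.keys p. Poly_Mapping.single m (Poly_Mapping.lookup p m)) \<in> P"
    by (rule poly_koszul.subideal_sum[OF assms])
  then show ?thesis by (simp only: sum_single)
qed

lemma supported_eq_genideal:
  assumes "upclosed n D"
  shows "(supported D :: ((nat \<Rightarrow>\<^sub>0 nat) \<Rightarrow>\<^sub>0 'k::field) set)
    = genideal (poly_ring n) {Poly_Mapping.single m 1 | m. m \<in> D}"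
proof
  let ?G = "{Poly_Mapping.single m 1 | m. m \<in> D} :: ((nat \<Rightarrow>\<^sub>0 nat) \<Rightarrow>\<^sub>0 'k) set"
  have D: "D \<subseteq> expos n" using assms by (simp add: upclosed_def)
  then have G: "?G \<subseteq> carrier (poly_ring n)" using single_in_carrier by blast
  then have id: "poly_koszul.subideal n (genideal (poly_ring n) ?G)"
    using poly.genideal_ideal ideal_poly_ring_iff by blast
  show "supported D \<subseteq> genideal (poly_ring n) ?G"
  proof
    fix p :: "(nat \<Rightarrow>\<^sub>0 nat) \<Rightarrow>\<^sub>0 'k" assume p: "p \<in> supported D"
    show "p \<in> genideal (poly_ring n) ?G"
    proof (rule subideal_mem_if_monomials[OF id])
      fix m assume "m \<in> Poly_Mapping.keys p"
      then have "m \<in> D" using p by (auto simp: supported_def)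
      then have "Poly_Mapping.single m 1 \<in> genideal (poly_ring n) ?G"
        using poly.genideal_self[OF G] by blast
      then have "Poly_Mapping.single 0 (Poly_Mapping.lookup p m) * Poly_Mapping.single m 1
          \<in> genideal (poly_ring n) ?G"
        by (intro poly_koszul.subidealD(4)[OF id] single_in_carrier) simp_all
      then show "Poly_Mapping.single m (Poly_Mapping.lookup p m) \<in> genideal (poly_ring n) ?G"
        by (simp add: mult_single)
    qed
  qed
  show "genideal (poly_ring n) ?G \<subseteq> supported D"
    using subideal_supported[OF assms]
    by (intro poly.genideal_minimal) (auto simp: ideal_poly_ring_iff supported_def)
qed

lemma monomial_ideal_supported:
  assumes "upclosed n D"
  shows "monomial_ideal n (supported D :: ((nat \<Rightarrow>\<^sub>0 nat) \<Rightarrow>\<^sub>0 'k::field) set)"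
  unfolding monomial_ideal_def supported_eq_genideal[OF assms] monomials_def
  using assms by (intro exI[of _ "{Poly_Mapping.single m 1 | m. m \<in> D}"])
    (auto simp: upclosed_def expos_def)

text \<open>Exponents of a product are sums of exponents; conversely each term of a polynomial on
  the right is a product of two monomials, and \<open>ideal_prod\<close> is closed under
  sums.\<close>

lemma ideal_prod_supported:
  assumes "A \<subseteq> expos n" "B \<subseteq> expos n"
  shows "ideal_prod (poly_ring n) (supported A) (supported B)
    = (supported {a + b | a b. a \<in> A \<and> b \<in> B} :: ((nat \<Rightarrow>\<^sub>0 nat) \<Rightarrow>\<^sub>0 'k::field) set)"
    (is "?L = ?R")
proof
  show "?L \<subseteq> ?R"
  proof
    fix p assume "p \<in> ?L"
    then show "p \<in> ?R"
    proof (induction rule: ideal_prod.induct)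
      case (prod i j)
      then show ?case using Poly_Mapping.keys_mult[of i j] by (fastforce simp: supported_def)
    next
      case (sum p q)
      then show ?case using Poly_Mapping.keys_add[of p q] by (auto simp: supported_def)
    qed
  qed
  show "?R \<subseteq> ?L"
  proof
    fix p assume p: "p \<in> ?R"
    \<comment> \<open>\<open>ideal_prod\<close> has no rule for zero, so the empty sum is obtained
      as \<open>0 * 0\<close>.\<close>
    have sum: "sum f T \<in> ?L" if "\<And>i. i \<in> T \<Longrightarrow> f i \<in> ?L" for f and T :: "(nat \<Rightarrow>\<^sub>0 nat) set"
      using that
    proof (induction T rule: infinite_finite_induct)
      case (insert i T)
      then show ?case using ideal_prod.sum[of "f i" "poly_ring n"] by simp
    qed (use ideal_prod.prod[of 0 "supported A" 0 "supported B" "poly_ring n"] in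
        \<open>simp_all add: supported_def\<close>)
    have "Poly_Mapping.single m (Poly_Mapping.lookup p m) \<in> ?L" if m: "m \<in> Poly_Mapping.keys p" for m
    proof -
      obtain a b where ab: "a \<in> A" "b \<in> B" "m = a + b"
        using m p by (auto simp: supported_def)
      then show ?thesis
        using ideal_prod.prod[of "Poly_Mapping.single a (Poly_Mapping.lookup p m)" "supported A"
            "Poly_Mapping.single b 1" "supported B" "poly_ring n"]
        by (simp add: supported_def mult_single)
    qed
    then show "p \<in> ?L"
      using sum[of "Poly_Mapping.keys p" "\<lambda>m. Poly_Mapping.single m (Poly_Mapping.lookup p m)"]
      by (simp add: sum_single)
  qed
qed

lemma ideal_power_supported:
  assumes "D 0 = expos n" "\<And>k. D k \<subseteq> expos n"
    and "\<And>k. D (Suc k) = {a + b | a b. a \<in> D k \<and> b \<in> D 1}"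
  shows "ideal_power (poly_ring n) (supported (D 1)) k
    = (supported (D k) :: ((nat \<Rightarrow>\<^sub>0 nat) \<Rightarrow>\<^sub>0 'k::field) set)"
proof (induction k)
  case 0
  then show ?case
    by (simp add: ideal_power_def ideals_set_def assms(1) carrier_poly_ring_eq)
next
  case (Suc k)
  then show ?case
    using ideal_prod_supported[OF assms(2)[of k] assms(2)[of 1]] assms(3)[of k]
    by (simp add: ideal_power_def ideals_set_def)
qed

section \<open>Identification of variables with \<open>X_0\<close>\<close>

definition collapse :: "nat set \<Rightarrow> (nat \<Rightarrow>\<^sub>0 nat) \<Rightarrow> nat \<Rightarrow>\<^sub>0 nat"
  where "collapse V = push (\<lambda>i. if i \<in> V then 0 else i)"

lemma collapse_add: "collapse V (a + b) = collapse V a + collapse V b"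
  by (simp add: collapse_def push_add)

lemma collapse_single:
  "collapse V (Poly_Mapping.single i c) = Poly_Mapping.single (if i \<in> V then 0 else i) c"
  by (simp add: collapse_def)

lemma collapse_expos: "\<lbrakk>0 < n; m \<in> expos n\<rbrakk> \<Longrightarrow> collapse V m \<in> expos n"
  using keys_push[of "\<lambda>i. if i \<in> V then 0 else i" m] by (auto simp: expos_def collapse_def)

lemma lookup_collapse:
  assumes "finite V" "0 \<notin> V"
  shows "Poly_Mapping.lookup (collapse V m) i =
    (if i \<in> V then 0 else if i = 0 then Poly_Mapping.lookup m 0 + (\<Sum>v\<in>V. Poly_Mapping.lookup m v)
     else Poly_Mapping.lookup m i)"
proof -
  let ?h = "\<lambda>i. if i \<in> V then 0 else i"
  have "push ?h m = (\<Sum>j\<in>insert 0 (insert i V) \<union> Poly_Mapping.keys m.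
      Poly_Mapping.single (?h j) (Poly_Mapping.lookup m j))"
    using assms by (intro push_eq_sum) auto
  then have eq: "Poly_Mapping.lookup (collapse V m) i = (\<Sum>j\<in>insert 0 (insert i V) \<union> Poly_Mapping.keys m.
      if ?h j = i then Poly_Mapping.lookup m j else 0)"
    by (simp add: collapse_def lookup_sum lookup_single when_def)
  also have "\<dots> = (\<Sum>j\<in>(if i \<in> V then {} else if i = 0 then insert 0 V else {i}). Poly_Mapping.lookup m j)"
    using assms by (intro sum.mono_neutral_cong_right) (auto split: if_splits)
  finally show ?thesis using assms by simp
qed

text \<open>The preimage, under substituting \<open>X_0\<close> for each \<open>X_v\<close> with
  \<open>v \<in> V\<close>, of the image monomial ideal. It turns membership in an ideal with
  binomial generators into a condition on exponents.\<close>

definition collapsed_ideal :: "nat \<Rightarrow> (nat \<Rightarrow>\<^sub>0 nat) set \<Rightarrow> nat set \<Rightarrow> ((nat \<Rightarrow>\<^sub>0 nat) \<Rightarrow>\<^sub>0 'k::field) set"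
  where "collapsed_ideal n D V =
    {p \<in> carrier (poly_ring n). push (collapse V) p \<in> supported (collapse V ` D)}"

lemma subideal_collapsed_ideal:
  assumes "upclosed n D"
  shows "poly_koszul.subideal n (collapsed_ideal n D V :: ((nat \<Rightarrow>\<^sub>0 nat) \<Rightarrow>\<^sub>0 'k::field) set)"
  unfolding poly_koszul.subideal_def
proof (intro conjI ballI)
  show "(collapsed_ideal n D V :: ((nat \<Rightarrow>\<^sub>0 nat) \<Rightarrow>\<^sub>0 'k) set) \<subseteq> carrier (poly_ring n)"
    by (auto simp: collapsed_ideal_def)
  show "(0 :: (nat \<Rightarrow>\<^sub>0 nat) \<Rightarrow>\<^sub>0 'k) \<in> collapsed_ideal n D V"
    by (simp add: collapsed_ideal_def supported_def poly_closed)
  fix p :: "(nat \<Rightarrow>\<^sub>0 nat) \<Rightarrow>\<^sub>0 'k" assume p: "p \<in> collapsed_ideal n D V"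
  show "p + q \<in> collapsed_ideal n D V" if "q \<in> collapsed_ideal n D V" for q
    using that p Poly_Mapping.keys_add[of "push (collapse V) p" "push (collapse V) q"]
    by (auto simp: collapsed_ideal_def supported_def push_add intro: poly_closed)
  show "c * p \<in> collapsed_ideal n D V" if c: "c \<in> carrier (poly_ring n)" for c
  proof -
    have "m \<in> collapse V ` D" if m: "m \<in> Poly_Mapping.keys (push (collapse V) (c * p))" for m
    proof -
      obtain a b where ab: "m = a + b" "a \<in> Poly_Mapping.keys (push (collapse V) c)"
          "b \<in> Poly_Mapping.keys (push (collapse V) p)"
        using m Poly_Mapping.keys_mult[of "push (collapse V) c" "push (collapse V) p"]
        by (auto simp: push_mult collapse_add)
      obtain a' where a': "a = collapse V a'" "a' \<in> expos n"
        using ab(2) c keys_push[of "collapse V" c] unfolding carrier_poly_ring_eq supported_def by blast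
      obtain d where d: "b = collapse V d" "d \<in> D"
        using ab(3) p by (auto simp: collapsed_ideal_def supported_def)
      have "a' + d \<in> D" using assms a' d by (simp add: upclosed_def)
      then show ?thesis using ab a' d by (auto simp flip: collapse_add)
    qed
    then show ?thesis using p c by (auto simp: collapsed_ideal_def supported_def intro: poly_closed)
  qed
qed

text \<open>Modulo the binomials each monomial is congruent to its collapse, hence each polynomial
  to its pushforward. The pushforward of a member has only collapses of monomials from
  \<open>D\<close>, which are again in the ideal.\<close>

lemma genideal_Var_diff_eq_collapsed_ideal:
  assumes D: "upclosed n D" and V: "V \<subseteq> {0<..<n}" and n: "0 < n"
  shows "genideal (poly_ring n) (supported D \<union> (\<lambda>v. Var v - Var 0) ` V)
    = (collapsed_ideal n D V :: ((nat \<Rightarrow>\<^sub>0 nat) \<Rightarrow>\<^sub>0 'k::field) set)" (is "genideal _ ?G = _")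
proof
  have DE: "D \<subseteq> expos n" using D by (simp add: upclosed_def)
  have "Var v - Var 0 \<in> carrier (poly_ring n)" if "v \<in> V" for v
    using that V n by (intro poly_koszul.subidealD(6)[OF poly_koszul.subideal_carrier] Var_in_carrier) auto
  moreover have "supported D \<subseteq> carrier (poly_ring n)"
    unfolding carrier_poly_ring_eq supported_def using DE by blast
  ultimately have G: "?G \<subseteq> carrier (poly_ring n)" by blast
  have "Var v - Var 0 \<in> (collapsed_ideal n D V :: ((nat \<Rightarrow>\<^sub>0 nat) \<Rightarrow>\<^sub>0 'k) set)" if "v \<in> V" for v
  proof -
    have "push (collapse V) (Var v - Var 0) = (0 :: (nat \<Rightarrow>\<^sub>0 nat) \<Rightarrow>\<^sub>0 'k)"
      using that by (simp add: Var_def push_diff collapse_single)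
    then show ?thesis using that G by (auto simp: collapsed_ideal_def supported_def)
  qed
  moreover have "p \<in> collapsed_ideal n D V" if "p \<in> supported D" for p :: "(nat \<Rightarrow>\<^sub>0 nat) \<Rightarrow>\<^sub>0 'k"
  proof -
    have "Poly_Mapping.keys (push (collapse V) p) \<subseteq> collapse V ` D"
      using that keys_push[of "collapse V" p] unfolding supported_def by blast
    then show ?thesis using that G unfolding collapsed_ideal_def supported_def by blast
  qed
  ultimately show "genideal (poly_ring n) ?G \<subseteq> collapsed_ideal n D V"
    using subideal_collapsed_ideal[OF D]
    by (intro poly.genideal_minimal) (auto simp: ideal_poly_ring_iff)
  have id: "poly_koszul.subideal n (genideal (poly_ring n) ?G)"
    using G poly.genideal_ideal ideal_poly_ring_iff by blast
  note I = poly_koszul.subidealD[OF id]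
  \<comment> \<open>Exponents whose monomial is congruent to its collapse: closed under addition and
    containing the single variables, hence everything in \<open>expos n\<close>.\<close>
  define S where "S = {m \<in> expos n. Poly_Mapping.single m 1 - Poly_Mapping.single (collapse V m) 1
    \<in> genideal (poly_ring n) ?G}"
  have S_add: "a + b \<in> S" if "a \<in> S" "b \<in> S" for a b
  proof -
    let ?X = "\<lambda>m. Poly_Mapping.single m 1 :: (nat \<Rightarrow>\<^sub>0 nat) \<Rightarrow>\<^sub>0 'k"
    \<comment> \<open>The product is collapsed one factor at a time, first \<open>b\<close>, then
      \<open>a\<close>.\<close>
    have "?X a * (?X b - ?X (collapse V b)) + ?X (collapse V b) * (?X a - ?X (collapse V a))
        \<in> genideal (poly_ring n) ?G"
      using that n unfolding S_def by (intro I(3,4) single_in_carrier collapse_expos) auto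
    also have "?X a * (?X b - ?X (collapse V b)) + ?X (collapse V b) * (?X a - ?X (collapse V a))
        = ?X (a + b) - ?X (collapse V (a + b))"
      by (simp add: algebra_simps mult_single collapse_add)
    finally show ?thesis using that by (simp add: S_def expos_add)
  qed
  have S_zero: "0 \<in> S"
    using I(2) by (simp add: S_def expos_def collapse_def)
  have S_single: "Poly_Mapping.single i k \<in> S" if i: "i < n" for i k
  proof (induction k)
    case (Suc k)
    have "Poly_Mapping.single i 1 \<in> S"
    proof (cases "i \<in> V")
      case True
      then have "Var i - Var 0 \<in> genideal (poly_ring n) ?G"
        using poly.genideal_self[OF G] by blast
      then show ?thesis using True i by (simp add: S_def Var_def collapse_single expos_def)
    next
      case False
      then show ?thesis using i I(2) by (simp add: S_def collapse_single expos_def)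
    qed
    from S_add[OF this Suc] show ?case by (simp flip: single_add)
  qed (simp add: S_zero)
  have "m \<in> S" if "m \<in> expos n" for m
  proof -
    have "(\<Sum>i\<in>T. Poly_Mapping.single i (Poly_Mapping.lookup m i)) \<in> S" if "T \<subseteq> {..<n}" for T
      using that by (induction T rule: infinite_finite_induct) (auto simp: S_zero S_add S_single)
    from this[of "Poly_Mapping.keys m"] show ?thesis
      using that by (simp add: sum_single expos_def)
  qed
  then have diff: "Poly_Mapping.single m c - Poly_Mapping.single (collapse V m) c
      \<in> genideal (poly_ring n) ?G" if "m \<in> expos n" for m c
    using I(4)[of "Poly_Mapping.single m 1 - Poly_Mapping.single (collapse V m) 1"
        "Poly_Mapping.single 0 c"] that
    by (simp add: S_def right_diff_distrib mult_single single_in_carrier)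
  show "collapsed_ideal n D V \<subseteq> genideal (poly_ring n) ?G"
  proof
    fix p :: "(nat \<Rightarrow>\<^sub>0 nat) \<Rightarrow>\<^sub>0 'k" assume p: "p \<in> collapsed_ideal n D V"
    let ?q = "push (collapse V) p"
    have mon: "Poly_Mapping.single m c \<in> genideal (poly_ring n) ?G" if m: "m \<in> Poly_Mapping.keys ?q" for m c
    proof -
      obtain d where d: "d \<in> D" "m = collapse V d"
        using m p by (auto simp: collapsed_ideal_def supported_def)
      have "Poly_Mapping.single d c \<in> genideal (poly_ring n) ?G"
        using d(1) poly.genideal_self[OF G] by (auto simp: supported_def split: if_splits)
      from I(6)[OF this diff[of d c]] show ?thesis using d DE by auto
    qed
    have q: "?q \<in> genideal (poly_ring n) ?G"
      by (rule subideal_mem_if_monomials[OF id]) (rule mon)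
    have "p - ?q = (\<Sum>m\<in>Poly_Mapping.keys p. Poly_Mapping.single m (Poly_Mapping.lookup p m)
        - Poly_Mapping.single (collapse V m) (Poly_Mapping.lookup p m))"
      by (simp add: sum_subtractf sum_single push_def)
    also have "\<dots> \<in> genideal (poly_ring n) ?G"
      using p by (intro poly_koszul.subideal_sum[OF id] diff)
        (auto simp: collapsed_ideal_def carrier_poly_ring_eq supported_def)
    finally show "p \<in> genideal (poly_ring n) ?G"
      using I(3)[OF _ q] by fastforce
  qed
qed

text \<open>As \<open>v \<notin> V\<close>, the substitution fixes \<open>X_v - X_0\<close>. This
  moves the question to the collapsed exponent set, where
  \<open>keys_subset_if_Var_diff_mult\<close> applies.\<close>

lemma collapsed_ideal_nonzerodivisor:
  fixes p :: "(nat \<Rightarrow>\<^sub>0 nat) \<Rightarrow>\<^sub>0 'k::field"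
  assumes D: "upclosed n D" and V: "0 \<notin> V" "v \<notin> V" "0 < v" "v < n"
    and colon: "\<And>e N. \<lbrakk>Poly_Mapping.single v 1 + e \<in> collapse V ` D; Poly_Mapping.single 0 N + e \<in> collapse V ` D\<rbrakk>
      \<Longrightarrow> e \<in> collapse V ` D"
    and p: "p \<in> carrier (poly_ring n)" "(Var v - Var 0) * p \<in> collapsed_ideal n D V"
  shows "p \<in> collapsed_ideal n D V"
proof -
  have closed: "Poly_Mapping.single i 1 + e \<in> collapse V ` D"
    if i: "i \<in> {0, v}" and e: "e \<in> collapse V ` D" for i e
  proof -
    obtain d where d: "d \<in> D" "e = collapse V d" using e by blast
    have "Poly_Mapping.single i 1 + d \<in> D" using D d i V by (auto simp: upclosed_def expos_def)
    moreover have "collapse V (Poly_Mapping.single i 1 + d) = Poly_Mapping.single i 1 + e"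
      using V i d by (auto simp: collapse_add collapse_single)
    ultimately show ?thesis by force
  qed
  have "push (collapse V) ((Var v - Var 0) * p) = (Var v - Var 0) * push (collapse V) p"
    using V by (simp add: push_mult collapse_add push_diff Var_def collapse_single)
  then have keys: "Poly_Mapping.keys ((Var v - Var 0) * push (collapse V) p) \<subseteq> collapse V ` D"
    using p by (simp add: collapsed_ideal_def supported_def)
  have "v \<noteq> 0" using V by simp
  from this keys have "Poly_Mapping.keys (push (collapse V) p) \<subseteq> collapse V ` D"
  proof (rule keys_subset_if_Var_diff_mult)
    show "Poly_Mapping.single v 1 + e \<in> collapse V ` D" if "e \<in> collapse V ` D" for e
      using closed that by blast
    show "Poly_Mapping.single 0 1 + e \<in> collapse V ` D" if "e \<in> collapse V ` D" for e
      using closed that by blast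
  qed (rule colon)
  then show ?thesis using p by (simp add: collapsed_ideal_def supported_def)
qed

section \<open>The ideal and its powers\<close>

text \<open>
  \<open>x\<^sup>a y\<^sup>b z\<^sup>c\<close> lies in the \<open>k\<close>-th power of \<open>(x\<^bsup>t-1\<^esup> y, x\<^bsup>t-2\<^esup> y z, z\<^sup>t)\<close>.
\<close>

definition block :: "nat \<Rightarrow> nat \<Rightarrow> nat \<Rightarrow> nat \<Rightarrow> nat \<Rightarrow> bool"
  where "block t k a b c \<longleftrightarrow>
    (\<exists>p q r. p + q + r = k \<and> (t - 1) * p + (t - 2) * q \<le> a \<and> p + q \<le> b \<and> q + t * r \<le> c)"

section \<open>Exponents in the powers of one factor\<close>

lemma blockI:
  "\<lbrakk>p + q + r = k; (t - 1) * p + (t - 2) * q \<le> a; p + q \<le> b; q + t * r \<le> c\<rbrakk> \<Longrightarrow> block t k a b c"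
  unfolding block_def by blast

lemma block_mono:
  assumes "block t k a b c" "a \<le> a'" "b \<le> b'" "c \<le> c'"
  shows "block t k a' b' c'"
proof -
  obtain p q r where "p + q + r = k" "(t - 1) * p + (t - 2) * q \<le> a" "p + q \<le> b" "q + t * r \<le> c"
    using assms(1) unfolding block_def by blast
  then show ?thesis using assms(2-) by (intro blockI[of p q r]) linarith+
qed

lemma block_0 [simp]: "block t 0 a b c"
  by (simp add: block_def)

lemma block_add:
  assumes "block t k a b c" "block t l a' b' c'"
  shows "block t (k + l) (a + a') (b + b') (c + c')"
proof -
  obtain p q r p' q' r' where
    "p + q + r = k" "(t - 1) * p + (t - 2) * q \<le> a" "p + q \<le> b" "q + t * r \<le> c"
    "p' + q' + r' = l" "(t - 1) * p' + (t - 2) * q' \<le> a'" "p' + q' \<le> b'" "q' + t * r' \<le> c'"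
    using assms unfolding block_def by blast
  then show ?thesis
    by (intro blockI[of "p + p'" "q + q'" "r + r'"]) (simp_all add: distrib_left)
qed

text \<open>One of the three multiplicities is positive, and a generator of that kind is split
  off.\<close>

lemma block_Suc:
  assumes "block t (Suc k) a b c"
  obtains a' b' c' where "a' \<le> a" "b' \<le> b" "c' \<le> c" "block t k (a - a') (b - b') (c - c')" "block t 1 a' b' c'"
proof -
  obtain p q r where h: "p + q + r = Suc k" "(t - 1) * p + (t - 2) * q \<le> a" "p + q \<le> b" "q + t * r \<le> c"
    using assms unfolding block_def by blast
  consider p' where "p = Suc p'" | q' where "q = Suc q'" | r' where "r = Suc r'"
    using h(1) by (metis add_is_0 not0_implies_Suc)
  then show thesis
  proof cases
    case 1
    with h show thesis
      by (intro that[of "t - 1" 1 0] blockI[of p' q r] blockI[of 1 0 0]) auto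
  next
    case 2
    with h show thesis
      by (intro that[of "t - 2" 1 1] blockI[of p q' r] blockI[of 0 1 0]) auto
  next
    case 3
    with h show thesis
      by (intro that[of 0 0 t] blockI[of p q r'] blockI[of 0 0 1]) auto
  qed
qed

text \<open>
  For \<open>k < t\<close> and fixed \<open>c\<close>, the ideal of all \<open>x\<^sup>a y\<^sup>b\<close> is principal: the factorization that uses
  \<open>z\<^sup>t\<close> most often and, subject to this, \<open>x\<^bsup>t-1\<^esup> y\<close> least often minimizes both exponents.
\<close>

lemma block_min:
  assumes t: "2 \<le> t" and k: "k < t" and "block t k a b c" "block t k a' b' c"
  shows "block t k (min a a') (min b b') c"
proof -
  have wlog: "block t k (min a a') (min b b') c"
    if h: "p + q + r = k" "(t - 1) * p + (t - 2) * q \<le> a" "p + q \<le> b" "q + t * r \<le> c"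
      and h': "p' + q' + r' = k" "(t - 1) * p' + (t - 2) * q' \<le> a'" "p' + q' \<le> b'" "q' + t * r' \<le> c"
      and r: "r' < r \<or> r = r' \<and> p \<le> p'" for p q r p' q' r' a a' b b'
  proof -
    obtain u where u: "t = u + 2" using t by (metis add.commute le_Suc_ex)
    have x: "(t - 1) * p + (t - 2) * q = u * (p + q) + p" "(t - 1) * p' + (t - 2) * q' = u * (p' + q') + p'"
      by (simp_all add: u algebra_simps)
    \<comment> \<open>If \<open>r' < r\<close>, then \<open>u * (p + q)\<close> is smaller by at
      least \<open>u\<close>. Some factor is \<open>z^t\<close>, so \<open>p < k < t\<close> gives
      \<open>p \<le> u\<close>, and the saving pays for \<open>p\<close>.\<close>
    have "u * (p + q) + p \<le> u * (p' + q') + p'"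
      using r
    proof
      assume "r' < r"
      then have "p + q + 1 \<le> p' + q'" using h(1) h'(1) by linarith
      then have "u * (p + q + 1) \<le> u * (p' + q')" by (rule mult_le_mono2)
      moreover have "p \<le> u" using \<open>r' < r\<close> h(1) k u by linarith
      ultimately show ?thesis by (simp add: algebra_simps)
    next
      assume "r = r' \<and> p \<le> p'"
      then show ?thesis using h(1) h'(1) by (metis add_le_cancel_left add_right_cancel)
    qed
    moreover have "p + q \<le> p' + q'" using r h(1) h'(1) by linarith
    ultimately have A: "(t - 1) * p + (t - 2) * q \<le> min a a'" and B: "p + q \<le> min b b'"
      using h(2,3) h'(2,3) unfolding x by linarith+
    show ?thesis using h(1) A B h(4) by (rule blockI)
  qed
  obtain p q r p' q' r' where
    h: "p + q + r = k" "(t - 1) * p + (t - 2) * q \<le> a" "p + q \<le> b" "q + t * r \<le> c" and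
    h': "p' + q' + r' = k" "(t - 1) * p' + (t - 2) * q' \<le> a'" "p' + q' \<le> b'" "q' + t * r' \<le> c"
    using assms(3,4) unfolding block_def by blast
  consider "r' < r \<or> r = r' \<and> p \<le> p'" | "r < r' \<or> r' = r \<and> p' \<le> p" by linarith
  then show ?thesis
    using wlog[OF h h'] wlog[OF h' h] by cases (simp_all add: min.commute)
qed

text \<open>Without \<open>z\<close>, only the generator \<open>x^(t-1) y\<close> is
  available.\<close>

lemma block_lower_bound_small:
  assumes "2 \<le> t" "block t k a b 0"
  shows "t * k \<le> a + b"
proof -
  have "(t - 1) * k \<le> a" "k \<le> b" using assms by (auto simp: block_def)
  then have "(t - 1) * k + k \<le> a + b" by linarith
  moreover have "(t - 1) * k + k = t * k" using assms(1) by (simp add: algebra_simps)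
  ultimately show ?thesis by simp
qed

text \<open>At most \<open>k - 1\<close> factors contain \<open>y\<close>, so one factor is
  \<open>z^t\<close>. It uses up the \<open>z\<close>-degree, and the other \<open>k - 1\<close>
  factors are \<open>x^(t-1) y\<close>.\<close>

lemma block_lower_bound_large:
  assumes "2 \<le> t" "1 \<le> k" "block t k a (k - 1) t"
  shows "(k - 1) * (t - 1) \<le> a"
proof -
  obtain p q r where h: "p + q + r = k" "(t - 1) * p + (t - 2) * q \<le> a" "p + q \<le> k - 1" "q + t * r \<le> t"
    using assms(3) unfolding block_def by blast
  then have "1 \<le> r" using assms(2) by linarith
  moreover have "r < 2"
  proof (rule ccontr)
    assume "\<not> r < 2"
    then have "t * 2 \<le> t * r" by (intro mult_le_mono2) simp
    then show False using h(4) assms(1) by linarith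
  qed
  ultimately have "r = 1" by simp
  then have "q = 0" "p = k - 1" using h by auto
  then show ?thesis using h(2) by (simp add: mult.commute)
qed

text \<open>One \<open>z\<close> saves one \<open>x\<close>: a factor \<open>x^(t-1) y\<close>
  becomes \<open>x^(t-2) y z\<close>.\<close>

lemma block_small:
  assumes "2 \<le> t" "1 \<le> k"
  shows "block t k ((t - 1) * k) k 0" "block t k ((t - 1) * k - 1) k 1"
proof -
  show "block t k ((t - 1) * k) k 0" by (rule blockI[of k 0 0]) auto
  obtain u l where "t = u + 2" "k = l + 1" using assms by (metis add.commute le_Suc_ex)
  then show "block t k ((t - 1) * k - 1) k 1"
    by (intro blockI[of "k - 1" 1 0]) (auto simp: algebra_simps)
qed

text \<open>Starting from \<open>(x^(t-1) y)^(k-1) z^t\<close>, one more \<open>y\<close> or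
  \<open>z\<close> saves one \<open>x\<close>. For \<open>y\<close>, trade \<open>z^t\<close> and
  \<open>t - 1\<close> factors \<open>x^(t-1) y\<close> for \<open>t\<close> factors
  \<open>x^(t-2) y z\<close>, which is possible as \<open>t \<le> k\<close>; for \<open>z\<close>,
  change one \<open>x^(t-1) y\<close> into \<open>x^(t-2) y z\<close>.\<close>

lemma block_large:
  assumes "2 \<le> t" "t \<le> k"
  shows "block t k ((k - 1) * (t - 1)) (k - 1) t"
    "block t k ((k - 1) * (t - 1) - 1) k t"
    "block t k ((k - 1) * (t - 1) - 1) (k - 1) (t + 1)"
proof -
  obtain u l where ul: "t = u + 2" "k = t + l" using assms by (metis add.commute le_Suc_ex)
  show "block t k ((k - 1) * (t - 1)) (k - 1) t"
    using assms by (intro blockI[of "k - 1" 0 1]) auto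
  show "block t k ((k - 1) * (t - 1) - 1) k t"
    using ul by (intro blockI[of "k - t" t 0]) (auto simp: algebra_simps)
  show "block t k ((k - 1) * (t - 1) - 1) (k - 1) (t + 1)"
    using ul by (intro blockI[of "k - 2" 1 1]) (auto simp: algebra_simps)
qed

text \<open>
  The variables are \<open>X\<^sub>0\<close>, then \<open>w\<close> variables each called \<open>x\<close>, \<open>y\<close>, \<open>z\<close>, then free ones.
\<close>

definition point :: "nat \<Rightarrow> nat \<Rightarrow> nat \<Rightarrow> (nat \<Rightarrow> nat) \<Rightarrow> (nat \<Rightarrow> nat) \<Rightarrow> (nat \<Rightarrow> nat) \<Rightarrow> nat \<Rightarrow>\<^sub>0 nat"
  where "point n w m a b c = (\<Sum>i<n. Poly_Mapping.single i
    (if i = 0 then m else if i \<le> w then a (i - 1) else if i \<le> 2 * w then b (i - w - 1)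
     else if i \<le> 3 * w then c (i - 2 * w - 1) else 0))"

lemma lookup_point:
  "Poly_Mapping.lookup (point n w m a b c) i = (if i < n then
    (if i = 0 then m else if i \<le> w then a (i - 1) else if i \<le> 2 * w then b (i - w - 1)
     else if i \<le> 3 * w then c (i - 2 * w - 1) else 0) else 0)"
  unfolding point_def lookup_sum lookup_single when_def by (simp only: sum.delta finite_lessThan lessThan_iff)

lemma point_expos: "point n w m a b c \<in> expos n"
  by (auto simp: expos_def in_keys_iff lookup_point split: if_splits)

lemma expos_iff: "m \<in> expos n \<longleftrightarrow> (\<forall>i\<ge>n. Poly_Mapping.lookup m i = 0)"
  unfolding expos_def subset_iff mem_Collect_eq in_keys_iff lessThan_iff by (metis not_less)

section \<open>The product ideal and its powers\<close>

locale depth_construction =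
  fixes n w :: nat and t :: "nat \<Rightarrow> nat"
  assumes n: "3 * w < n" and t: "s < w \<Longrightarrow> 2 \<le> t s"
begin

text \<open>The factors use disjoint variables, so a power of the product is tested factor by
  factor; the condition at index 0 belongs to the factor \<open>X_0\<close>.\<close>

definition power_exps :: "nat \<Rightarrow> (nat \<Rightarrow>\<^sub>0 nat) set"
  where "power_exps k = {e \<in> expos n. k \<le> Poly_Mapping.lookup e 0 \<and>
    (\<forall>s<w. block (t s) k (Poly_Mapping.lookup e (Suc s)) (Poly_Mapping.lookup e (Suc (w + s)))
      (Poly_Mapping.lookup e (Suc (2 * w + s))))}"

lemma lookup_point_simps:
  "Poly_Mapping.lookup (point n w m a b c) 0 = m"
  "s < w \<Longrightarrow> Poly_Mapping.lookup (point n w m a b c) (Suc s) = a s"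
  "s < w \<Longrightarrow> Poly_Mapping.lookup (point n w m a b c) (Suc (w + s)) = b s"
  "s < w \<Longrightarrow> Poly_Mapping.lookup (point n w m a b c) (Suc (2 * w + s)) = c s"
  "3 * w < i \<Longrightarrow> Poly_Mapping.lookup (point n w m a b c) i = 0"
  using n by (auto simp: lookup_point)

lemma index_cases:
  assumes "i < n"
  obtains "i = 0" | s where "s < w" "i = Suc s" | s where "s < w" "i = Suc (w + s)"
    | s where "s < w" "i = Suc (2 * w + s)" | "3 * w < i"
proof -
  consider "i = 0" | "0 < i" "i \<le> w" | "w < i" "i \<le> 2 * w" | "2 * w < i" "i \<le> 3 * w" | "3 * w < i"
    by linarith
  then show thesis
  proof cases
    case 2
    then show thesis using that(2)[of "i - 1"] by simp
  next
    case 3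
    then show thesis using that(3)[of "i - w - 1"] by simp
  next
    case 4
    then show thesis using that(4)[of "i - 2 * w - 1"] by simp
  qed (use that in auto)
qed

lemma point_power_exps:
  "point n w m a b c \<in> power_exps k \<longleftrightarrow> k \<le> m \<and> (\<forall>s<w. block (t s) k (a s) (b s) (c s))"
  by (simp add: power_exps_def point_expos lookup_point_simps)

lemma power_exps_0: "power_exps 0 = expos n"
  by (auto simp: power_exps_def)

lemma upclosed_power_exps: "upclosed n (power_exps k)"
  unfolding upclosed_def power_exps_def
  by (auto simp: expos_add lookup_add intro: block_mono)

lemma power_exps_Suc: "power_exps (Suc k) = {a + b | a b. a \<in> power_exps k \<and> b \<in> power_exps 1}"
proof (intro equalityI subsetI)
  fix e assume e: "e \<in> power_exps (Suc k)"
  let ?l = "Poly_Mapping.lookup e"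
  have "\<exists>a b c. a \<le> ?l (Suc s) \<and> b \<le> ?l (Suc (w + s)) \<and> c \<le> ?l (Suc (2 * w + s)) \<and>
      block (t s) k (?l (Suc s) - a) (?l (Suc (w + s)) - b) (?l (Suc (2 * w + s)) - c) \<and> block (t s) 1 a b c"
    if "s < w" for s
  proof -
    have "block (t s) (Suc k) (?l (Suc s)) (?l (Suc (w + s))) (?l (Suc (2 * w + s)))"
      using e that by (simp add: power_exps_def)
    then show ?thesis by (rule block_Suc) blast
  qed
  then obtain a b c where abc: "\<And>s. s < w \<Longrightarrow> a s \<le> ?l (Suc s) \<and> b s \<le> ?l (Suc (w + s))
      \<and> c s \<le> ?l (Suc (2 * w + s)) \<and> block (t s) k (?l (Suc s) - a s) (?l (Suc (w + s)) - b s)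
        (?l (Suc (2 * w + s)) - c s) \<and> block (t s) 1 (a s) (b s) (c s)"
    by metis
  \<comment> \<open>Collects the generators split off in all factors, together with one
    \<open>X_0\<close>.\<close>
  define d where "d = point n w 1 a b c"
  have d: "d \<in> power_exps 1" using abc by (simp add: d_def point_power_exps)
  have "Poly_Mapping.lookup d i \<le> ?l i" for i
  proof (cases "i < n")
    case True
    then show ?thesis
      using e abc by (cases rule: index_cases) (auto simp: d_def lookup_point_simps power_exps_def)
  qed (simp add: d_def lookup_point)
  then have ed: "e = (e - d) + d"
    by (intro poly_mapping_eqI) (simp add: lookup_add lookup_minus)
  moreover have "e - d \<in> power_exps k"
    using e abc by (auto simp: power_exps_def lookup_minus expos_iff d_def lookup_point_simps)
  ultimately show "e \<in> {a + b | a b. a \<in> power_exps k \<and> b \<in> power_exps 1}"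
    using d by blast
next
  fix e assume "e \<in> {a + b | a b. a \<in> power_exps k \<and> b \<in> power_exps 1}"
  then obtain a b where ab: "e = a + b" "a \<in> power_exps k" "b \<in> power_exps 1" by blast
  have "block (t s) (k + 1)
      (Poly_Mapping.lookup a (Suc s) + Poly_Mapping.lookup b (Suc s))
      (Poly_Mapping.lookup a (Suc (w + s)) + Poly_Mapping.lookup b (Suc (w + s)))
      (Poly_Mapping.lookup a (Suc (2 * w + s)) + Poly_Mapping.lookup b (Suc (2 * w + s)))"
    if "s < w" for s
    using ab that by (intro block_add) (auto simp: power_exps_def)
  then show "e \<in> power_exps (Suc k)"
    using ab by (auto simp: power_exps_def lookup_add expos_add)
qed

section \<open>The variables to be identified with \<open>X_0\<close>\<close>

definition collapsed_vars :: "nat \<Rightarrow> nat set"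
  where "collapsed_vars k = Suc ` {..<w} \<union> (\<lambda>s. Suc (w + s)) ` {s. s < w \<and> k < t s} \<union> {3 * w<..<n}"

lemma finite_collapsed_vars: "finite (collapsed_vars k)"
  by (simp add: collapsed_vars_def)

lemma collapsed_vars_subset: "collapsed_vars k \<subseteq> {0<..<n}"
  using n by (auto simp: collapsed_vars_def)

lemma collapsed_vars_iff:
  "s < w \<Longrightarrow> Suc s \<in> collapsed_vars k"
  "s < w \<Longrightarrow> Suc (w + s) \<in> collapsed_vars k \<longleftrightarrow> k < t s"
  "s < w \<Longrightarrow> Suc (2 * w + s) \<notin> collapsed_vars k"
  "\<lbrakk>3 * w < i; i < n\<rbrakk> \<Longrightarrow> i \<in> collapsed_vars k"
  "0 \<notin> collapsed_vars k"
  by (auto simp: collapsed_vars_def)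

text \<open>The constant \<open>g = 1\<close> gives the length of the regular sequence; exponents as
  \<open>g\<close> give the degree that collapsing moves to \<open>X_0\<close>.\<close>

lemma sum_collapsed_vars:
  fixes g :: "nat \<Rightarrow> nat"
  shows "sum g (collapsed_vars k) = (\<Sum>s<w. g (Suc s) + (if k < t s then g (Suc (w + s)) else 0))
    + sum g {3 * w<..<n}"
proof -
  have "sum g (collapsed_vars k) = sum g (Suc ` {..<w})
      + sum g ((\<lambda>s. Suc (w + s)) ` {s. s < w \<and> k < t s}) + sum g {3 * w<..<n}"
    unfolding collapsed_vars_def by (subst sum.union_disjoint; (subst sum.union_disjoint)?) auto
  also have "sum g (Suc ` {..<w}) = (\<Sum>s<w. g (Suc s))"
    by (simp add: sum.reindex)
  also have "sum g ((\<lambda>s. Suc (w + s)) ` {s. s < w \<and> k < t s}) = (\<Sum>s\<in>{s \<in> {..<w}. k < t s}. g (Suc (w + s)))"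
    by (subst sum.reindex) (auto simp: inj_on_def)
  also have "\<dots> = (\<Sum>s<w. if k < t s then g (Suc (w + s)) else 0)"
    by (rule sum.inter_filter) simp
  finally show ?thesis by (simp add: sum.distrib)
qed

lemma card_collapsed_vars:
  "card (collapsed_vars k) = w + card {s. s < w \<and> k < t s} + (n - 1 - 3 * w)"
proof -
  have "card (collapsed_vars k) = (\<Sum>s<w. 1 + (if k < t s then 1 else 0)) + card {3 * w<..<n}"
    using sum_collapsed_vars[of "\<lambda>_. 1" k] by simp
  also have "\<dots> = w + (\<Sum>s<w. if k < t s then 1 else 0) + card {3 * w<..<n}"
    by (simp only: sum.distrib) simp
  also have "(\<Sum>s<w. if k < t s then 1 else 0) = card {s. s < w \<and> k < t s}"
    by (simp add: sum.inter_filter[symmetric])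
  finally show ?thesis by simp
qed

text \<open>The \<open>z\<close>-exponents of \<open>d\<close> and \<open>d'\<close> coincide, since
  no \<open>z\<close> is collapsed. For \<open>k < t s\<close>, \<open>block_min\<close> allows the
  \<open>v\<close>-exponent of \<open>d\<close> to drop to that of \<open>d'\<close>. For
  \<open>t s \<le> k\<close> the \<open>y\<close>-exponents coincide too, so only an
  \<open>x\<close>-exponent can change, and it changes to that of \<open>d'\<close>.\<close>

lemma collapse_power_exps_colon:
  assumes V: "V \<subseteq> collapsed_vars k" and v: "v \<in> collapsed_vars k" "v \<notin> V"
    and e: "Poly_Mapping.single v 1 + e \<in> collapse V ` power_exps k"
      "Poly_Mapping.single 0 N + e \<in> collapse V ` power_exps k"
  shows "e \<in> collapse V ` power_exps k"
proof -
  obtain d d' where d: "d \<in> power_exps k" "Poly_Mapping.single v 1 + e = collapse V d"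
    and d': "d' \<in> power_exps k" "Poly_Mapping.single 0 N + e = collapse V d'"
    using e by blast
  have finV: "finite V" "0 \<notin> V"
    using V finite_collapsed_vars finite_subset collapsed_vars_iff(5) by blast+
  have v0: "v \<noteq> 0" using v collapsed_vars_iff(5) by metis
  have l: "Poly_Mapping.lookup d i = Poly_Mapping.lookup e i + (if i = v then 1 else 0)"
      "Poly_Mapping.lookup d' i = Poly_Mapping.lookup e i" if "i \<notin> V" "i \<noteq> 0" for i
    using arg_cong[OF d(2), of "\<lambda>m. Poly_Mapping.lookup m i"]
      arg_cong[OF d'(2), of "\<lambda>m. Poly_Mapping.lookup m i"] that
    by (auto simp: lookup_add lookup_single lookup_collapse[OF finV] when_def)
  define d'' where "d'' = d - Poly_Mapping.single v 1"
  have "Poly_Mapping.lookup d v \<ge> 1" using l(1)[OF v(2) v0] by simp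
  then have dd: "d = Poly_Mapping.single v 1 + d''"
    by (intro poly_mapping_eqI) (auto simp: d''_def lookup_add lookup_minus lookup_single when_def)
  then have "collapse V d'' = e"
    using d(2) v(2) by (simp add: collapse_add collapse_single)
  moreover have "d'' \<in> power_exps k"
  proof -
    \<comment> \<open>At \<open>v\<close>, \<open>d\<close> exceeds \<open>e\<close> by one and
      \<open>d'\<close> agrees with \<open>e\<close>.\<close>
    have l'': "Poly_Mapping.lookup d'' i = (if i = v then Poly_Mapping.lookup d' v else Poly_Mapping.lookup d i)" for i
      using l[OF v(2) v0] by (auto simp: d''_def lookup_minus lookup_single when_def)
    have "block (t s) k (Poly_Mapping.lookup d'' (Suc s)) (Poly_Mapping.lookup d'' (Suc (w + s)))
        (Poly_Mapping.lookup d'' (Suc (2 * w + s)))" if s: "s < w" for s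
    proof -
      let ?x = "Suc s" and ?y = "Suc (w + s)" and ?z = "Suc (2 * w + s)"
      have B: "block (t s) k (Poly_Mapping.lookup d ?x) (Poly_Mapping.lookup d ?y) (Poly_Mapping.lookup d ?z)"
        "block (t s) k (Poly_Mapping.lookup d' ?x) (Poly_Mapping.lookup d' ?y) (Poly_Mapping.lookup d' ?z)"
        using d d' s by (auto simp: power_exps_def)
      have z: "?z \<noteq> v" "?z \<notin> V" using v V collapsed_vars_iff(3)[OF s] by blast+
      then have lz: "Poly_Mapping.lookup d'' ?z = Poly_Mapping.lookup d ?z"
          "Poly_Mapping.lookup d' ?z = Poly_Mapping.lookup d ?z"
        using l[of ?z] by (auto simp: l'')
      show ?thesis
      proof (cases "k < t s")
        case True
        show ?thesis
          by (rule block_mono[OF block_min[OF t[OF s] True B[unfolded lz]]]) (auto simp: l'' lz z(1)[symmetric])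
      next
        case False
        then have y: "?y \<noteq> v" "?y \<notin> V" using v V collapsed_vars_iff(2)[OF s] by blast+
        then have "Poly_Mapping.lookup d'' ?y = Poly_Mapping.lookup d ?y"
          "Poly_Mapping.lookup d' ?y = Poly_Mapping.lookup d ?y"
          using l[of ?y] by (auto simp: l'')
        then show ?thesis using B lz by (auto simp: l'')
      qed
    qed
    moreover have "d'' \<in> expos n" using d(1) by (auto simp: power_exps_def expos_iff d''_def lookup_minus)
    ultimately show ?thesis using d(1) v0 by (simp add: power_exps_def l'')
  qed
  ultimately show ?thesis by blast
qed

text \<open>The exponents wanted on the collapsed variables are taken out of the
  \<open>X_0\<close>-exponent of \<open>m\<close>, of which at least \<open>k\<close> must
  remain.\<close>

lemma in_collapse_power_exps:
  assumes m: "m \<in> expos n" "\<And>v. v \<in> collapsed_vars k \<Longrightarrow> Poly_Mapping.lookup m v = 0"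
    and ab: "\<And>s. s < w \<Longrightarrow> block (t s) k (a s) (b s) (Poly_Mapping.lookup m (Suc (2 * w + s)))"
      "\<And>s. \<lbrakk>s < w; t s \<le> k\<rbrakk> \<Longrightarrow> b s = Poly_Mapping.lookup m (Suc (w + s))"
    and le: "k + (\<Sum>s<w. a s + (if k < t s then b s else 0)) \<le> Poly_Mapping.lookup m 0"
  shows "m \<in> collapse (collapsed_vars k) ` power_exps k"
proof
  let ?S = "\<Sum>s<w. a s + (if k < t s then b s else 0)"
  define d where "d = point n w (Poly_Mapping.lookup m 0 - ?S) a b (\<lambda>s. Poly_Mapping.lookup m (Suc (2 * w + s)))"
  show "d \<in> power_exps k" using ab(1) le by (simp add: d_def point_power_exps)
  have "(\<Sum>s<w. Poly_Mapping.lookup d (Suc s) + (if k < t s then Poly_Mapping.lookup d (Suc (w + s)) else 0)) = ?S"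
    by (rule sum.cong) (auto simp: d_def lookup_point_simps)
  moreover have "sum (Poly_Mapping.lookup d) {3 * w<..<n} = 0"
    by (simp add: d_def lookup_point_simps)
  ultimately have S: "sum (Poly_Mapping.lookup d) (collapsed_vars k) = ?S"
    unfolding sum_collapsed_vars by simp
  show "m = collapse (collapsed_vars k) d"
  proof (rule poly_mapping_eqI)
    fix i
    show "Poly_Mapping.lookup m i = Poly_Mapping.lookup (collapse (collapsed_vars k) d) i"
    proof (cases "i < n")
      case True
      then show ?thesis
      proof (cases rule: index_cases)
        case 1
        then show ?thesis
          using le S by (simp add: lookup_collapse finite_collapsed_vars collapsed_vars_iff d_def lookup_point_simps)
      next
        case (3 s)
        then show ?thesis
          using m(2)[of i] ab(2)[of s]
          by (auto simp: lookup_collapse finite_collapsed_vars collapsed_vars_iff d_def lookup_point_simps)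
      qed (use m(2)[of i] True in
          \<open>auto simp: lookup_collapse finite_collapsed_vars collapsed_vars_iff d_def lookup_point_simps\<close>)
    next
      case False
      then have "i \<notin> collapsed_vars k" "i \<noteq> 0" using collapsed_vars_subset n by fastforce+
      then show ?thesis using m(1) False
        by (simp add: lookup_collapse finite_collapsed_vars collapsed_vars_iff d_def lookup_point expos_iff)
    qed
  qed
qed

section \<open>The socle monomial\<close>

definition cost :: "nat \<Rightarrow> nat \<Rightarrow> nat"
  where "cost k s = (if k < t s then t s * k else (k - 1) * (t s - 1))"

text \<open>One unit of \<open>X_0\<close> short of membership: \<open>cost k s\<close> is the least
  degree that factor \<open>s\<close> needs on its collapsed variables beside \<open>z^0\<close> if
  \<open>k < t s\<close>, and beside \<open>y^(k-1) z^t\<close> otherwise.\<close>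

definition socle :: "nat \<Rightarrow> nat \<Rightarrow>\<^sub>0 nat"
  where "socle k = point n w (k + (\<Sum>s<w. cost k s) - 1) (\<lambda>_. 0)
    (\<lambda>s. if k < t s then 0 else k - 1) (\<lambda>s. if k < t s then 0 else t s)"

lemma socle_collapsed_vars: "v \<in> collapsed_vars k \<Longrightarrow> Poly_Mapping.lookup (socle k) v = 0"
  by (auto simp: collapsed_vars_def socle_def lookup_point_simps)

lemma collapse_socle: "collapse (collapsed_vars k) (socle k) = socle k"
  by (rule poly_mapping_eqI)
     (simp add: lookup_collapse finite_collapsed_vars collapsed_vars_iff socle_collapsed_vars)

text \<open>A preimage would have \<open>X_0\<close>-exponent at least \<open>k\<close> and degree
  at least \<open>cost k s\<close> on the collapsed variables of each factor, one unit more than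
  there is.\<close>

lemma socle_notin:
  assumes k: "1 \<le> k"
  shows "socle k \<notin> collapse (collapsed_vars k) ` power_exps k"
proof
  assume "socle k \<in> collapse (collapsed_vars k) ` power_exps k"
  then obtain d where d: "d \<in> power_exps k" "socle k = collapse (collapsed_vars k) d" by blast
  have l: "Poly_Mapping.lookup (socle k) i = (if i \<in> collapsed_vars k then 0
    else if i = 0 then Poly_Mapping.lookup d 0 + sum (Poly_Mapping.lookup d) (collapsed_vars k)
     else Poly_Mapping.lookup d i)" for i
    unfolding d(2) by (rule lookup_collapse) (auto simp: finite_collapsed_vars collapsed_vars_iff)
  have cost: "cost k s \<le> Poly_Mapping.lookup d (Suc s) + (if k < t s then Poly_Mapping.lookup d (Suc (w + s)) else 0)"
    if s: "s < w" for s
  proof -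
    have B: "block (t s) k (Poly_Mapping.lookup d (Suc s)) (Poly_Mapping.lookup d (Suc (w + s)))
        (Poly_Mapping.lookup d (Suc (2 * w + s)))"
      using d(1) s by (simp add: power_exps_def)
    have z: "Poly_Mapping.lookup d (Suc (2 * w + s)) = (if k < t s then 0 else t s)"
      using l[of "Suc (2 * w + s)"] s by (simp add: collapsed_vars_iff socle_def lookup_point_simps)
    show ?thesis
    proof (cases "k < t s")
      case True
      then show ?thesis using block_lower_bound_small[OF t[OF s]] B z by (simp add: cost_def)
    next
      case False
      then have "Poly_Mapping.lookup d (Suc (w + s)) = k - 1"
        using l[of "Suc (w + s)"] s by (simp add: collapsed_vars_iff socle_def lookup_point_simps)
      then show ?thesis using block_lower_bound_large[OF t[OF s] k] B z False by (simp add: cost_def)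
    qed
  qed
  have "(\<Sum>s<w. cost k s) \<le> sum (Poly_Mapping.lookup d) (collapsed_vars k)"
    unfolding sum_collapsed_vars by (rule trans_le_add1, rule sum_mono, rule cost) simp
  moreover have "k \<le> Poly_Mapping.lookup d 0" using d(1) by (simp add: power_exps_def)
  moreover have "Poly_Mapping.lookup d 0 + sum (Poly_Mapping.lookup d) (collapsed_vars k)
      = k + (\<Sum>s<w. cost k s) - 1"
    using l[of 0] by (simp add: collapsed_vars_iff socle_def lookup_point_simps)
  ultimately show False using k by linarith
qed

text \<open>\<open>X_0\<close> supplies the missing unit. An uncollapsed \<open>y\<close> or
  \<open>z\<close> allows one \<open>x\<close> less in its factor, by \<open>block_small\<close> and
  \<open>block_large\<close>, which frees a unit.\<close>

lemma Var_plus_socle_in: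
  assumes k: "1 \<le> k" and i: "i < n" "i \<notin> collapsed_vars k"
  shows "Poly_Mapping.single i 1 + socle k \<in> collapse (collapsed_vars k) ` power_exps k"
proof -
  \<comment> \<open>\<open>a\<close> and \<open>b\<close> are the exponents of \<open>x\<close> and
    \<open>y\<close> that attain \<open>cost k s\<close>.\<close>
  define a where "a s = (if k < t s then (t s - 1) * k else (k - 1) * (t s - 1))" for s
  define b where "b s = (if k < t s then k else k - 1)" for s
  have sum: "a s + (if k < t s then b s else 0) = cost k s" if s: "s < w" for s
  proof -
    have "(t s - 1) * k + k = t s * k" using t[OF s] by (simp add: algebra_simps)
    then show ?thesis by (simp add: a_def b_def cost_def)
  qed
  have pos: "1 \<le> a s" if "s < w" for s
    using t[OF that] k by (simp add: a_def Suc_le_eq)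
  have E: "Poly_Mapping.single i 1 + socle k \<in> expos n"
    using i by (intro expos_add) (auto simp: socle_def point_expos, simp add: expos_def)
  have Z: "Poly_Mapping.lookup (Poly_Mapping.single i 1 + socle k) v = 0" if "v \<in> collapsed_vars k" for v
    using that i by (auto simp: lookup_add lookup_single when_def socle_collapsed_vars)
  have base: "block (t s) k (a s) (b s) (Poly_Mapping.lookup (socle k) (Suc (2 * w + s)))" if "s < w" for s
    using block_small[OF t[OF that] k] block_large[OF t[OF that], of k] that
    by (simp add: a_def b_def socle_def lookup_point_simps)
  have yz: ?thesis if s0: "s0 < w" and i': "i = Suc (w + s0) \<or> i = Suc (2 * w + s0)" for s0
  proof -
    \<comment> \<open>One \<open>x\<close> less in factor \<open>s0\<close>, where
      \<open>pos\<close> keeps the subtraction exact.\<close>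
    define a' where "a' s = (if s = s0 then a s - 1 else a s)" for s
    define b' where "b' s = (if s = s0 \<and> i = Suc (w + s0) then k else b s)" for s
    have yE: "t s0 \<le> k" if "i = Suc (w + s0)" using that i(2) s0 by (simp add: collapsed_vars_iff)
    have ab': "a' s + (if k < t s then b' s else 0) + (if s = s0 then 1 else 0) = cost k s" if "s < w" for s
      using sum[OF that] pos[OF that] yE by (auto simp: a'_def b'_def)
    have "(\<Sum>s<w. a' s + (if k < t s then b' s else 0)) + (\<Sum>s<w. if s = s0 then 1 else 0) = (\<Sum>s<w. cost k s)"
      unfolding sum.distrib[symmetric] by (rule sum.cong) (use ab' in simp_all)
    then have S: "(\<Sum>s<w. a' s + (if k < t s then b' s else 0)) + 1 = (\<Sum>s<w. cost k s)"
      using s0 by simp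
    show ?thesis
    proof (rule in_collapse_power_exps[OF E Z, where a = a' and b = b'])
      fix s assume s: "s < w"
      show "block (t s) k (a' s) (b' s) (Poly_Mapping.lookup (Poly_Mapping.single i 1 + socle k) (Suc (2 * w + s)))"
      proof (cases "s = s0")
        case True
        then show ?thesis
          using i' yE s block_small(2)[OF t[OF s] k] block_large(2,3)[OF t[OF s], of k]
          by (auto simp: a'_def b'_def a_def b_def lookup_add lookup_single when_def socle_def lookup_point_simps)
      next
        case False
        then have "i \<noteq> Suc (2 * w + s)" using i' s s0 by auto
        then show ?thesis
          using base[OF s] False by (simp add: a'_def b'_def lookup_add lookup_single when_def)
      qed
      show "b' s = Poly_Mapping.lookup (Poly_Mapping.single i 1 + socle k) (Suc (w + s))" if "t s \<le> k"
        using that i' s s0 k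
        by (auto simp: b'_def b_def lookup_add lookup_single when_def socle_def lookup_point_simps)
    qed (use S i' in \<open>auto simp: lookup_add lookup_single when_def socle_def lookup_point_simps\<close>)
  qed
  from i(1) show ?thesis
  proof (cases rule: index_cases)
    case 1
    show ?thesis
    proof (rule in_collapse_power_exps[OF E Z, where a = a and b = b])
      have "(\<Sum>s<w. a s + (if k < t s then b s else 0)) = (\<Sum>s<w. cost k s)"
        using sum by simp
      then show "k + (\<Sum>s<w. a s + (if k < t s then b s else 0))
          \<le> Poly_Mapping.lookup (Poly_Mapping.single i 1 + socle k) 0"
        using 1 by (simp add: lookup_add socle_def lookup_point_simps)
    qed (use base 1 in \<open>auto simp: b_def lookup_add lookup_single when_def socle_def lookup_point_simps\<close>)
  qed (use i yz in \<open>auto simp: collapsed_vars_iff\<close>)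
qed

lemma depth_power:
  assumes k: "1 \<le> k"
  shows "depth (poly_ring n) (graded_maximal_ideal n) (quotient_module (poly_ring n)
      (ideal_power (poly_ring n) (supported (power_exps 1) :: ((nat \<Rightarrow>\<^sub>0 nat) \<Rightarrow>\<^sub>0 'k::field) set) k))
    = enat (card (collapsed_vars k))"
proof -
  let ?J = "supported (power_exps k) :: ((nat \<Rightarrow>\<^sub>0 nat) \<Rightarrow>\<^sub>0 'k) set"
  have pow: "ideal_power (poly_ring n) (supported (power_exps 1)) k = ?J"
  proof (rule ideal_power_supported[OF power_exps_0 _ power_exps_Suc])
    show "power_exps k \<subseteq> expos n" for k by (auto simp: power_exps_def)
  qed
  have J: "ideal ?J (poly_ring n)"
    using subideal_supported[OF upclosed_power_exps] by (simp add: ideal_poly_ring_iff)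
  \<comment> \<open>Any order will do, as \<open>collapse_power_exps_colon\<close> holds for every
    subset \<open>V\<close> of the collapsed variables.\<close>
  obtain vs where vs: "set vs = collapsed_vars k" "distinct vs"
    using finite_collapsed_vars finite_distinct_list by blast
  define ys :: "((nat \<Rightarrow>\<^sub>0 nat) \<Rightarrow>\<^sub>0 'k) list" where "ys = map (\<lambda>v. Var v - Var 0) vs"
  have Idl: "genideal (poly_ring n) (?J \<union> set (take i ys)) = collapsed_ideal n (power_exps k) (set (take i vs))" for i
  proof -
    have "set (take i vs) \<subseteq> {0<..<n}"
      using vs(1) collapsed_vars_subset set_take_subset[of i vs] by blast
    moreover have "set (take i ys) = (\<lambda>v. Var v - Var 0) ` set (take i vs)"
      by (simp add: ys_def take_map)
    ultimately show ?thesis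
      using genideal_Var_diff_eq_collapsed_ideal[OF upclosed_power_exps] n by simp
  qed
  from this[of "length vs"] have Idl_all:
    "genideal (poly_ring n) (?J \<union> set ys) = collapsed_ideal n (power_exps k) (collapsed_vars k)"
    by (simp add: ys_def vs)
  have m: "poly_koszul.subideal n (graded_maximal_ideal n :: ((nat \<Rightarrow>\<^sub>0 nat) \<Rightarrow>\<^sub>0 'k) set)"
    using ideal_graded_maximal_ideal ideal_poly_ring_iff by blast
  have "{Var i | i. i < n} \<subseteq> (carrier (poly_ring n) :: ((nat \<Rightarrow>\<^sub>0 nat) \<Rightarrow>\<^sub>0 'k) set)"
    using Var_in_carrier by blast
  then have Var: "Var i \<in> (graded_maximal_ideal n :: ((nat \<Rightarrow>\<^sub>0 nat) \<Rightarrow>\<^sub>0 'k) set)" if "i < n" for i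
    using that poly.genideal_self unfolding graded_maximal_ideal_eq by blast
  have "depth (poly_ring n) (graded_maximal_ideal n) (quotient_module (poly_ring n) ?J) = enat (length ys)"
  proof (rule depth_quotient_eqI[OF J])
    show "set ys \<subseteq> graded_maximal_ideal n"
    proof
      fix y assume "y \<in> set ys"
      then obtain v where "v \<in> collapsed_vars k" "y = Var v - Var 0" using vs by (auto simp: ys_def)
      moreover from this have "v < n" using collapsed_vars_subset by fastforce
      ultimately show "y \<in> graded_maximal_ideal n"
        using poly_koszul.subidealD(6)[OF m Var Var, of v 0] by simp
    qed
  next
    fix i p assume i: "i < length ys" and p: "p \<in> carrier (poly_ring n)"
      and yp: "ys ! i * p \<in> genideal (poly_ring n) (?J \<union> set (take i ys))"
    let ?V = "set (take i vs)"
    have i': "i < length vs" using i by (simp add: ys_def)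
    have V: "?V \<subseteq> collapsed_vars k" using vs(1) set_take_subset[of i vs] by simp
    have v: "vs ! i \<in> collapsed_vars k" using nth_mem[OF i'] vs(1) by simp
    have notin: "vs ! i \<notin> ?V"
      using i' vs(2) by (auto simp: in_set_conv_nth nth_eq_iff_index_eq)
    show "p \<in> genideal (poly_ring n) (?J \<union> set (take i ys))"
      unfolding Idl
    proof (rule collapsed_ideal_nonzerodivisor[OF upclosed_power_exps _ notin _ _ _ p])
      show "0 \<notin> ?V" using V collapsed_vars_iff(5) by blast
      show "0 < vs ! i" "vs ! i < n" using v collapsed_vars_subset by fastforce+
      show "(Var (vs ! i) - Var 0) * p \<in> collapsed_ideal n (power_exps k) ?V"
        using yp i unfolding Idl by (simp add: ys_def)
    qed (rule collapse_power_exps_colon[OF V v notin])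
  next
    let ?u = "Poly_Mapping.single (socle k) 1 :: (nat \<Rightarrow>\<^sub>0 nat) \<Rightarrow>\<^sub>0 'k"
    have sE: "socle k \<in> expos n" by (simp add: socle_def point_expos)
    then show "?u \<in> carrier (poly_ring n)" by (rule single_in_carrier)
    show "?u \<notin> genideal (poly_ring n) (?J \<union> set ys)"
      unfolding Idl_all using socle_notin[OF k]
      by (simp add: collapsed_ideal_def collapse_socle supported_def)
    fix i assume i: "i < n"
    \<comment> \<open>Modulo the sequence, a collapsed variable acts as \<open>X_0\<close>.\<close>
    let ?j = "if i \<in> collapsed_vars k then 0 else i"
    have "Poly_Mapping.single ?j 1 + socle k \<in> collapse (collapsed_vars k) ` power_exps k"
      using Var_plus_socle_in[OF k, of ?j] i by (auto simp: collapsed_vars_iff)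
    moreover have "Poly_Mapping.single i 1 + socle k \<in> expos n"
      using i sE by (intro expos_add) (auto simp: expos_def)
    ultimately show "Var i * ?u \<in> genideal (poly_ring n) (?J \<union> set ys)"
      unfolding Idl_all
      by (simp add: collapsed_ideal_def Var_def mult_single single_in_carrier supported_def
          collapse_add collapse_single collapse_socle)
  qed
  also have "length ys = card (collapsed_vars k)"
    using vs distinct_card[OF vs(2)] by (simp add: ys_def)
  finally show ?thesis unfolding pow .
qed

end

section \<open>The depth function\<close>

text \<open>A set of natural numbers has a least element; once a decreasing sequence reaches its
  least value, it stays there.\<close>

lemma decseq_nat_eventually_const:
  fixes f :: "nat \<Rightarrow> nat"
  assumes "decseq f"
  obtains K where "\<And>k. k \<ge> K \<Longrightarrow> f k = lim f" "\<And>k. lim f \<le> f k"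
proof -
  define m where "m = (LEAST m. \<exists>k. f k = m)"
  obtain K where K: "f K = m"
    using LeastI_ex[of "\<lambda>m. \<exists>k. f k = m"] unfolding m_def by blast
  have min: "m \<le> f k" for k
    unfolding m_def by (rule Least_le) blast
  have const: "f k = m" if "k \<ge> K" for k
    using decseqD[OF assms that] K min[of k] by simp
  then have "f \<longlonglongrightarrow> m"
    by (intro tendsto_eventually) (auto simp: eventually_sequentially)
  then have "lim f = m" by (rule limI)
  then show thesis using that const min by blast
qed

theorem corollary3p10:
  fixes f :: "nat \<Rightarrow> nat"
  assumes "decseq f"
    and "f 0 = 2 * lim f + 1"
    and "decseq (Delta f)"
  shows "\<exists>(n::nat) (I :: ((nat \<Rightarrow>\<^sub>0 nat) \<Rightarrow>\<^sub>0 'k::field) set).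
    monomial_ideal n I \<and>
    (\<forall>k\<ge>1. depth (poly_ring n) (graded_maximal_ideal n)
              (quotient_module (poly_ring n) (ideal_power (poly_ring n) I k)) = enat (f k))"
proof -
  define c where "c = lim f"
  obtain K where K: "\<And>k. k \<ge> K \<Longrightarrow> f k = c" and c: "\<And>k. c \<le> f k"
    using decseq_nat_eventually_const[OF assms(1)] unfolding c_def by blast
  \<comment> \<open>Otherwise \<open>Delta f 0 \<le> 0\<close>; as \<open>Delta f\<close> is
    decreasing, \<open>f\<close> never descends, so \<open>f 0 \<le> c\<close>, against
    \<open>f 0 = 2 * c + 1\<close>.\<close>
  have "f 1 < f 0"
  proof (rule ccontr)
    assume "\<not> f 1 < f 0"
    then have D: "Delta f k \<le> 0" for k
      using decseqD[OF assms(3), of 0 k] by (simp add: Delta_def)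
    have "f 0 \<le> f k" for k
    proof (induction k)
      case (Suc k)
      then show ?case using D[of k] by (simp add: Delta_def)
    qed simp
    from this[of K] show False using K[of K] assms(2) by (simp add: c_def)
  qed
  define w where "w = f 1 - c"
  \<comment> \<open>The strict descent gives \<open>f 1 \<le> 2 * c\<close>, so the number
    \<open>c - w\<close> of free variables below is not truncated.\<close>
  have w: "w \<le> c" "f 1 = c + w"
    using \<open>f 1 < f 0\<close> assms(2) c[of 1] by (simp_all add: w_def c_def)
  define t where "t s = (LEAST k. f k \<le> c + s)" for s
  have t_iff: "k < t s \<longleftrightarrow> c + s < f k" for k s
  proof -
    have "f (t s) \<le> c + s"
      unfolding t_def by (rule LeastI[of _ K]) (simp add: K)
    then have "f k \<le> c + s" if "t s \<le> k"
      using decseqD[OF assms(1) that] by simp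
    moreover have "t s \<le> k" if "f k \<le> c + s"
      unfolding t_def using that by (rule Least_le)
    ultimately show ?thesis by (meson not_le)
  qed
  \<comment> \<open>\<open>X_0\<close>, three variables for each of the \<open>w\<close> factors,
    and \<open>c - w\<close> free ones.\<close>
  define n where "n = 1 + 3 * w + (c - w)"
  interpret depth_construction n w t
  proof
    show "2 \<le> t s" if "s < w" for s
      using that t_iff[of 1 s] w by simp
  qed (simp add: n_def)
  have card: "card (collapsed_vars k) = f k" if "1 \<le> k" for k
  proof -
    have "f k \<le> c + w" using decseqD[OF assms(1) that] w by simp
    \<comment> \<open>The \<open>y\<close> variables collapsed for \<open>k\<close> are those of the
      unit steps of \<open>f\<close> still to come after \<open>k\<close>; the bound on
      \<open>f k\<close> keeps their indices below \<open>w\<close>.\<close>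
    then have "{s. s < w \<and> k < t s} = {..<f k - c}" by (auto simp: t_iff)
    then show ?thesis
      using w c[of k] unfolding card_collapsed_vars by (simp add: n_def)
  qed
  have "\<forall>k\<ge>1. depth (poly_ring n) (graded_maximal_ideal n) (quotient_module (poly_ring n)
      (ideal_power (poly_ring n) (supported (power_exps 1) :: ((nat \<Rightarrow>\<^sub>0 nat) \<Rightarrow>\<^sub>0 'k) set) k)) = enat (f k)"
  proof (intro allI impI)
    fix k :: nat assume "1 \<le> k"
    from depth_power[OF this] card[OF this]
    show "depth (poly_ring n) (graded_maximal_ideal n) (quotient_module (poly_ring n)
      (ideal_power (poly_ring n) (supported (power_exps 1) :: ((nat \<Rightarrow>\<^sub>0 nat) \<Rightarrow>\<^sub>0 'k) set) k)) = enat (f k)"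
      by simp
  qed
  then show ?thesis
    using monomial_ideal_supported[OF upclosed_power_exps] by blast
qed

end
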